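(* Let $n\ge2$, $0\le\kappa\le n-2$, $(\epsilon_1,\ldots,\epsilon_n)=(1^\kappa,0^{n-\kappa})$, $l,m\in\mathbb Z_{\ge0}$, and let $R(z)\in\mathrm{End}(\mathcal W_l\otimes\mathcal W_m)$, $z=x/y$, be the quantum $R$ matrix of $\mathcal U_A(1^\kappa,0^{n-\kappa})$ normalized by $R(z)(|l\mathbf e_n\rangle\otimes|m\mathbf e_n\rangle)=|l\mathbf e_n\rangle\otimes|m\mathbf e_n\rangle$. With $P(u\otimes v)=v\otimes u$, one has the spectral decomposition $$PR(z)=\sum_{s=0}^{\min(l,m)}\left(\prod_{i=1}^s\frac{1-q^{l+m-2i+2}z}{z-q^{l+m-2i+2}}\right)\mathscr P^{l,m}_s .$$
   Context: $q^{1/2},x,y$ are generic (algebraically independent indeterminates over $\mathbb C$), vector spaces are over $\mathbb C(q^{1/2},x,y)$; $[m]=\frac{q^m-q^{-m}}{q-q^{-1}}$, $[m]!=\prod_{k=1}^m[k]$, ${s\brack j}=\frac{[s]!}{[j]![s-j]!}$. $F$ has basis $|m\rangle$, $m\in\mathbb Z_{\ge0}$; $V$ has basis $|0\rangle,|1\rangle$; $\mathcal W=V^{\otimes\kappa}\otimes F^{\otimes(n-\kappa)}$ has basis $|\mathbf m\rangle=|m_1,\ldots,m_n\rangle$ ($m_i\in\{0,1\}$ for $i\le\kappa$, $m_i\in\mathbb Z_{\ge0}$ for $i>\kappa$); $\mathcal W_l$ is the span of $|\mathbf m\rangle$ with $m_1+\cdots+m_n=l$. $\mathbf e_i$ is the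 $i$th standard basis vector of $\mathbb Z^n$. $\mathcal U_A(\epsilon_1,\ldots,\epsilon_n)$: put $q_i=q$ if $\epsilon_i=0$ and $q_i=-q^{-1}$ if $\epsilon_i=1$; indices are in $\mathbb Z/n\mathbb Z$; $D_{i,j}=\prod_{k\in\{i,i+1\}\cap\{j,j+1\}}q_k^{2\delta_{i,j}-1}$. Generators $e_i,f_i,k_i^{\pm1}$ ($0\le i\le n-1$), relations $k_ik_i^{-1}=k_i^{-1}k_i=1$, $[k_i,k_j]=0$, $k_ie_j=D_{i,j}e_jk_i$, $k_if_j=D_{i,j}^{-1}f_jk_i$, $[e_i,f_j]=\delta_{i,j}\frac{k_i-k_i^{-1}}{q-q^{-1}}$; coproduct $\Delta k_i^{\pm1}=k_i^{\pm1}\otimes k_i^{\pm1}$, $\Delta e_i=1\otimes e_i+e_i\otimes k_i$, $\Delta f_i=f_i\otimes1+k_i^{-1}\otimes f_i$; $\Delta'$ is the opposite coproduct. $\overline{\mathcal U}_A$ is the subalgebra generated by $e_i,f_i,k_i^{\pm1}$ with $1\le i\le n-1$. Representation $\pi_x$ on $\mathcal W_l$ (vectors with indices out of range are zero): $e_i|\mathbf m\rangle=x^{\delta_{i,0}}[m_i]|\mathbf m-\mathbf e_i+\mathbf e_{i+1}\rangle$, $f_i|\mathbf m\rangle=x^{-\delta_{i,0}}[m_{i+1}]|\mathbf m+\mathbf e_i-\mathbf e_{i+1}\rangle$, $k_i|\mathbf m\rangle=q_i^{-m_i}q_{i+1}^{m_{i+1}}|\mathbf m\rangle$. Quantum $R$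 matrix: $R(z)$ is determined by $(\pi_x\otimes\pi_y)\Delta'(g)R(z)=R(z)(\pi_x\otimes\pi_y)\Delta(g)$ for all $g\in\mathcal U_A$ and the stated normalization. For $0\le s\le\min(l,m)$, $$\xi^{l,m}_s=\sum_{j=0}^s(-1)^jq^{j(2s-m-j-1)+ms}{s\brack j}\,|0,\ldots,0,j,l-j\rangle\otimes|0,\ldots,0,s-j,m-s+j\rangle\in\mathcal W_l\otimes\mathcal W_m$$ (with $n-2$ leading zeros in each factor). $\mathscr P^{l,m}_s:\mathcal W_l\otimes\mathcal W_m\to\mathcal W_m\otimes\mathcal W_l$ is the linear map characterized by $\mathscr P^{l,m}_s\xi^{l,m}_{s'}=\delta_{s,s'}\xi^{m,l}_s$ for $0\le s'\le\min(l,m)$ and $(\pi_y\otimes\pi_x)\Delta(g)\mathscr P^{l,m}_s=\mathscr P^{l,m}_s(\pi_x\otimes\pi_y)\Delta(g)$ for all $g\in\overline{\mathcal U}_A$. *)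

theory Defs
  imports
    Complex_Main
    "HOL-Library.Poly_Mapping"
    "HOL-Library.Product_Plus"
    "HOL-Computational_Algebra.Polynomial"
    "HOL-Computational_Algebra.Fraction_Field"
    "HOL-Algebra.QuotRing"
begin

section \<open>The ground field\<close>

text \<open>The field of rational functions over the complex numbers in three indeterminates, as the
  fraction field of \<open>((\<complex>[q\<^sup>1\<^sup>/\<^sup>2])[x])[y]\<close>.\<close>

type_synonym scal = "complex poly poly poly fract"

definition q_half :: scal where "q_half = Fract [:[:[:0, 1:]:]:] 1"
definition x_par :: scal where "x_par = Fract [:[:0, 1:]:] 1"
definition y_par :: scal where "y_par = Fract [:0, 1:] 1"
definition q_par :: scal where "q_par = q_half ^ 2"

definition qint :: "nat \<Rightarrow> scal" where
  "qint m = (q_par powi int m - q_par powi (- int m)) / (q_par - inverse q_par)"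

definition qfact :: "nat \<Rightarrow> scal" where
  "qfact m = (\<Prod>k = 1..m. qint k)"

definition qbinom :: "nat \<Rightarrow> nat \<Rightarrow> scal" where
  "qbinom s j = qfact s / (qfact j * qfact (s - j))"

section \<open>Free vector spaces\<close>

text \<open>The vector space with basis \<open>'b\<close> is the type \<open>'b \<Rightarrow>\<^sub>0 scal\<close> of finitely supported functions.\<close>

definition smul :: "scal \<Rightarrow> ('b \<Rightarrow>\<^sub>0 scal) \<Rightarrow> ('b \<Rightarrow>\<^sub>0 scal)"  (infixr "\<cdot>\<^sub>K" 75) where
  "c \<cdot>\<^sub>K v = Poly_Mapping.map (\<lambda>a. c * a) v"

definition ket :: "'b \<Rightarrow> ('b \<Rightarrow>\<^sub>0 scal)" where
  "ket b = Poly_Mapping.single b 1"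

definition linext :: "('b \<Rightarrow> ('c \<Rightarrow>\<^sub>0 scal)) \<Rightarrow> ('b \<Rightarrow>\<^sub>0 scal) \<Rightarrow> ('c \<Rightarrow>\<^sub>0 scal)" where
  "linext f v = (\<Sum>b\<in>Poly_Mapping.keys v. Poly_Mapping.lookup v b \<cdot>\<^sub>K f b)"

text \<open>The tensor product of the free vector spaces on \<open>'b\<close> and \<open>'c\<close> is the one on \<open>'b \<times> 'c\<close>.\<close>

definition tens :: "('b \<Rightarrow>\<^sub>0 scal) \<Rightarrow> ('c \<Rightarrow>\<^sub>0 scal) \<Rightarrow> ('b \<times> 'c \<Rightarrow>\<^sub>0 scal)" where
  "tens u v = linext (\<lambda>b. linext (\<lambda>c. ket (b, c)) v) u"

definition tens_op ::
  "(('b \<Rightarrow>\<^sub>0 scal) \<Rightarrow> ('b \<Rightarrow>\<^sub>0 scal)) \<Rightarrow> (('c \<Rightarrow>\<^sub>0 scal) \<Rightarrow> ('c \<Rightarrow>\<^sub>0 scal)) \<Rightarrow>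
    ('b \<times> 'c \<Rightarrow>\<^sub>0 scal) \<Rightarrow> ('b \<times> 'c \<Rightarrow>\<^sub>0 scal)" where
  "tens_op S T = linext (\<lambda>(b, c). tens (S (ket b)) (T (ket c)))"

definition tens_swap :: "('b \<times> 'c \<Rightarrow>\<^sub>0 scal) \<Rightarrow> ('c \<times> 'b \<Rightarrow>\<^sub>0 scal)" where
  "tens_swap = linext (\<lambda>(b, c). ket (c, b))"

definition lin_hom ::
  "('b \<Rightarrow>\<^sub>0 scal) set \<Rightarrow> ('c \<Rightarrow>\<^sub>0 scal) set \<Rightarrow> (('b \<Rightarrow>\<^sub>0 scal) \<Rightarrow> ('c \<Rightarrow>\<^sub>0 scal)) set" where
  "lin_hom A B = {T. (\<forall>v\<in>A. T v \<in> B) \<and> (\<forall>v\<in>A. \<forall>w\<in>A. T (v + w) = T v + T w) \<and>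
                     (\<forall>c. \<forall>v\<in>A. T (c \<cdot>\<^sub>K v) = c \<cdot>\<^sub>K T v)}"

section \<open>The algebra \<open>U\<^sub>A(\<epsilon>\<^sub>1,\<dots>,\<epsilon>\<^sub>n)\<close>\<close>

text \<open>\<open>cyc n i\<close> is the representative of \<open>i\<close> modulo \<open>n\<close> in \<open>{1..n}\<close>, the range of the indices
  of \<open>\<epsilon>\<close>, \<open>q\<close> and of the components of \<open>\<^bold>m\<close>. The generators carry indices in \<open>{..<n}\<close>.\<close>

definition cyc :: "nat \<Rightarrow> nat \<Rightarrow> nat" where
  "cyc n i = (if i mod n = 0 then n else i mod n)"

definition q_idx :: "nat \<Rightarrow> (nat \<Rightarrow> nat) \<Rightarrow> nat \<Rightarrow> scal" where
  "q_idx n \<epsilon> i = (if \<epsilon> (cyc n i) = 0 then q_par else - inverse q_par)"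

definition D_mat :: "nat \<Rightarrow> (nat \<Rightarrow> nat) \<Rightarrow> nat \<Rightarrow> nat \<Rightarrow> scal" where
  "D_mat n \<epsilon> i j = (\<Prod>k \<in> {cyc n i, cyc n (i + 1)} \<inter> {cyc n j, cyc n (j + 1)}.
      q_idx n \<epsilon> k powi (if i = j then 1 else - 1))"

datatype gen = Gen_e nat | Gen_f nat | Gen_k nat | Gen_kinv nat

primrec gen_index :: "gen \<Rightarrow> nat" where
  "gen_index (Gen_e i) = i"
| "gen_index (Gen_f i) = i"
| "gen_index (Gen_k i) = i"
| "gen_index (Gen_kinv i) = i"

text \<open>Words form the free monoid, written additively so that the convolution product of
  \<^theory>\<open>HOL-Library.Poly_Mapping\<close> makes \<open>word \<Rightarrow>\<^sub>0 scal\<close> the free associative unital algebra, and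
  \<open>word \<times> word \<Rightarrow>\<^sub>0 scal\<close> its tensor square.\<close>

datatype word = Word (letters: "gen list")

instantiation word :: monoid_add
begin

definition zero_word :: word where "zero_word = Word []"
definition plus_word :: "word \<Rightarrow> word \<Rightarrow> word" where
  "plus_word u v = Word (letters u @ letters v)"

instance
  by standard (simp_all add: zero_word_def plus_word_def)

end

definition emb :: "gen \<Rightarrow> (word \<Rightarrow>\<^sub>0 scal)" where
  "emb g = ket (Word [g])"

abbreviation "gen_e i \<equiv> emb (Gen_e i)"
abbreviation "gen_f i \<equiv> emb (Gen_f i)"
abbreviation "gen_k i \<equiv> emb (Gen_k i)"
abbreviation "gen_kinv i \<equiv> emb (Gen_kinv i)"

definition free_carrier :: "nat set \<Rightarrow> (word \<Rightarrow>\<^sub>0 scal) set" where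
  "free_carrier J = {a. \<forall>w\<in>Poly_Mapping.keys a. \<forall>g\<in>set (letters w). gen_index g \<in> J}"

definition free_alg :: "nat set \<Rightarrow> (word \<Rightarrow>\<^sub>0 scal) ring" where
  "free_alg J = \<lparr>carrier = free_carrier J, monoid.mult = (*), one = 1, zero = 0, add = (+)\<rparr>"

lemma free_carrier_mult:
  assumes "a \<in> free_carrier J" "b \<in> free_carrier J"
  shows "a * b \<in> free_carrier J"
proof -
  have "Poly_Mapping.keys (a * b) \<subseteq> {u + v |u v. u \<in> Poly_Mapping.keys a \<and> v \<in> Poly_Mapping.keys b}"
    by (rule keys_mult)
  then show ?thesis
    using assms unfolding free_carrier_def plus_word_def by fastforce
qed

lemma free_carrier_add:
  assumes "a \<in> free_carrier J" "b \<in> free_carrier J"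
  shows "a + b \<in> free_carrier J"
  using assms Poly_Mapping.keys_add[of a b] unfolding free_carrier_def by blast

lemma ring_free_alg: "ring (free_alg J)"
proof (rule ringI)
  show "abelian_group (free_alg J)"
  proof (rule abelian_groupI)
    fix a assume "a \<in> carrier (free_alg J)"
    then show "\<exists>b\<in>carrier (free_alg J). b \<oplus>\<^bsub>free_alg J\<^esub> a = \<zero>\<^bsub>free_alg J\<^esub>"
      by (intro bexI[of _ "- a"]) (simp_all add: free_alg_def free_carrier_def)
  qed (simp_all add: free_alg_def free_carrier_add ac_simps, simp add: free_carrier_def)
  show "Group.monoid (free_alg J)"
    by (rule monoidI)
       (simp_all add: free_alg_def free_carrier_mult mult.assoc, simp add: free_carrier_def zero_word_def)
qed (simp_all add: free_alg_def algebra_simps)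

definition UA_rels :: "nat \<Rightarrow> (nat \<Rightarrow> nat) \<Rightarrow> (word \<Rightarrow>\<^sub>0 scal) set" where
  "UA_rels n \<epsilon> =
     (\<Union>i<n. {gen_k i * gen_kinv i - 1, gen_kinv i * gen_k i - 1}) \<union>
     (\<Union>i<n. \<Union>j<n.
       {gen_k i * gen_k j - gen_k j * gen_k i,
        gen_k i * gen_e j - D_mat n \<epsilon> i j \<cdot>\<^sub>K (gen_e j * gen_k i),
        gen_k i * gen_f j - inverse (D_mat n \<epsilon> i j) \<cdot>\<^sub>K (gen_f j * gen_k i),
        gen_e i * gen_f j - gen_f j * gen_e i
          - (if i = j then inverse (q_par - inverse q_par) \<cdot>\<^sub>K (gen_k i - gen_kinv i) else 0)})"

definition UA_ideal :: "nat \<Rightarrow> (nat \<Rightarrow> nat) \<Rightarrow> (word \<Rightarrow>\<^sub>0 scal) set" where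
  "UA_ideal n \<epsilon> = genideal (free_alg {..<n}) (UA_rels n \<epsilon>)"

definition UA :: "nat \<Rightarrow> (nat \<Rightarrow> nat) \<Rightarrow> (word \<Rightarrow>\<^sub>0 scal) set ring" where
  "UA n \<epsilon> = free_alg {..<n} Quot UA_ideal n \<epsilon>"

text \<open>The elements of \<open>UA\<close> that are represented by noncommutative polynomials in the generators
  with index in \<open>{1..<n}\<close>.\<close>

definition UA_bar :: "nat \<Rightarrow> (nat \<Rightarrow> nat) \<Rightarrow> (word \<Rightarrow>\<^sub>0 scal) set set" where
  "UA_bar n \<epsilon> = (\<lambda>a. UA_ideal n \<epsilon> +>\<^bsub>free_alg {..<n}\<^esub> a) ` free_carrier {1..<n}"

section \<open>Coproducts\<close>

text \<open>The coproducts are given on the free algebra; they and the representations below respect the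
  defining relations, so the action of an element of \<open>UA\<close> can be computed with any representative.\<close>

primrec Delta_gen :: "gen \<Rightarrow> (word \<times> word \<Rightarrow>\<^sub>0 scal)" where
  "Delta_gen (Gen_e i) = tens 1 (gen_e i) + tens (gen_e i) (gen_k i)"
| "Delta_gen (Gen_f i) = tens (gen_f i) 1 + tens (gen_kinv i) (gen_f i)"
| "Delta_gen (Gen_k i) = tens (gen_k i) (gen_k i)"
| "Delta_gen (Gen_kinv i) = tens (gen_kinv i) (gen_kinv i)"

definition Delta :: "(word \<Rightarrow>\<^sub>0 scal) \<Rightarrow> (word \<times> word \<Rightarrow>\<^sub>0 scal)" where
  "Delta = linext (\<lambda>w. prod_list (map Delta_gen (letters w)))"

definition Delta_op :: "(word \<Rightarrow>\<^sub>0 scal) \<Rightarrow> (word \<times> word \<Rightarrow>\<^sub>0 scal)" where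
  "Delta_op g = tens_swap (Delta g)"

section \<open>The spaces \<open>W\<close>, \<open>W\<^sub>l\<close> and the representation \<open>\<pi>\<^sub>x\<close>\<close>

text \<open>A multi-index \<open>\<^bold>m = (m\<^sub>1,\<dots>,m\<^sub>n)\<close> is a function vanishing outside \<open>{1..n}\<close>.
  The \<open>i\<close>-th tensor factor is \<open>V\<close> if \<open>\<epsilon>\<^sub>i = 1\<close> and \<open>F\<close> if \<open>\<epsilon>\<^sub>i = 0\<close>.\<close>

type_synonym midx = "nat \<Rightarrow> nat"

definition midxs :: "nat \<Rightarrow> (nat \<Rightarrow> nat) \<Rightarrow> midx set" where
  "midxs n \<epsilon> = {m. (\<forall>i. i \<notin> {1..n} \<longrightarrow> m i = 0) \<and> (\<forall>i\<in>{1..n}. \<epsilon> i = 1 \<longrightarrow> m i \<in> {0, 1})}"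

definition midxs_deg :: "nat \<Rightarrow> (nat \<Rightarrow> nat) \<Rightarrow> nat \<Rightarrow> midx set" where
  "midxs_deg n \<epsilon> l = {m \<in> midxs n \<epsilon>. (\<Sum>i = 1..n. m i) = l}"

definition WW :: "nat \<Rightarrow> (nat \<Rightarrow> nat) \<Rightarrow> nat \<Rightarrow> nat \<Rightarrow> (midx \<times> midx \<Rightarrow>\<^sub>0 scal) set" where
  "WW n \<epsilon> l m = {v. Poly_Mapping.keys v \<subseteq> midxs_deg n \<epsilon> l \<times> midxs_deg n \<epsilon> m}"

definition ket_in :: "nat \<Rightarrow> (nat \<Rightarrow> nat) \<Rightarrow> midx \<Rightarrow> (midx \<Rightarrow>\<^sub>0 scal)" where
  "ket_in n \<epsilon> m = (if m \<in> midxs n \<epsilon> then ket m else 0)"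

text \<open>\<open>shift a b m\<close> is \<open>\<^bold>m - \<^bold>e\<^sub>a + \<^bold>e\<^sub>b\<close>. For \<open>m a = 0\<close>, where the subtraction is truncated, the
  result only occurs with the coefficient \<open>qint 0 = 0\<close>.\<close>

definition shift :: "nat \<Rightarrow> nat \<Rightarrow> midx \<Rightarrow> midx" where
  "shift a b m = m(a := m a - 1, b := m b + 1)"

definition k_eigval :: "nat \<Rightarrow> (nat \<Rightarrow> nat) \<Rightarrow> nat \<Rightarrow> midx \<Rightarrow> scal" where
  "k_eigval n \<epsilon> i m = q_idx n \<epsilon> i powi (- int (m (cyc n i)))
                     * q_idx n \<epsilon> (i + 1) powi int (m (cyc n (i + 1)))"

primrec pi_gen :: "nat \<Rightarrow> (nat \<Rightarrow> nat) \<Rightarrow> scal \<Rightarrow> gen \<Rightarrow> midx \<Rightarrow> (midx \<Rightarrow>\<^sub>0 scal)" where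
  "pi_gen n \<epsilon> x (Gen_e i) m =
     ((if i = 0 then x else 1) * qint (m (cyc n i)))
       \<cdot>\<^sub>K ket_in n \<epsilon> (shift (cyc n i) (cyc n (i + 1)) m)"
| "pi_gen n \<epsilon> x (Gen_f i) m =
     ((if i = 0 then inverse x else 1) * qint (m (cyc n (i + 1))))
       \<cdot>\<^sub>K ket_in n \<epsilon> (shift (cyc n (i + 1)) (cyc n i) m)"
| "pi_gen n \<epsilon> x (Gen_k i) m = k_eigval n \<epsilon> i m \<cdot>\<^sub>K ket_in n \<epsilon> m"
| "pi_gen n \<epsilon> x (Gen_kinv i) m = inverse (k_eigval n \<epsilon> i m) \<cdot>\<^sub>K ket_in n \<epsilon> m"

definition pi_word ::
  "nat \<Rightarrow> (nat \<Rightarrow> nat) \<Rightarrow> scal \<Rightarrow> word \<Rightarrow> (midx \<Rightarrow>\<^sub>0 scal) \<Rightarrow> (midx \<Rightarrow>\<^sub>0 scal)" where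
  "pi_word n \<epsilon> x w = foldr (\<lambda>g. linext (pi_gen n \<epsilon> x g)) (letters w)"

text \<open>\<open>pi_pi n \<epsilon> x y\<close> is \<open>\<pi>\<^sub>x \<otimes> \<pi>\<^sub>y\<close> on the tensor square of the free algebra.\<close>

definition pi_pi ::
  "nat \<Rightarrow> (nat \<Rightarrow> nat) \<Rightarrow> scal \<Rightarrow> scal \<Rightarrow> (word \<times> word \<Rightarrow>\<^sub>0 scal) \<Rightarrow>
    (midx \<times> midx \<Rightarrow>\<^sub>0 scal) \<Rightarrow> (midx \<times> midx \<Rightarrow>\<^sub>0 scal)" where
  "pi_pi n \<epsilon> x y g v =
     linext (\<lambda>(u, w). tens_op (pi_word n \<epsilon> x u) (pi_word n \<epsilon> y w) v) g"

section \<open>The quantum \<open>R\<close> matrix and the operators \<open>P\<^sub>s\<^sup>l\<^sup>,\<^sup>m\<close>\<close>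

definition single_idx :: "nat \<Rightarrow> nat \<Rightarrow> midx" where
  "single_idx i a = (\<lambda>j. if j = i then a else 0)"

definition is_R_matrix ::
  "nat \<Rightarrow> (nat \<Rightarrow> nat) \<Rightarrow> nat \<Rightarrow> nat \<Rightarrow>
    ((midx \<times> midx \<Rightarrow>\<^sub>0 scal) \<Rightarrow> (midx \<times> midx \<Rightarrow>\<^sub>0 scal)) \<Rightarrow> bool" where
  "is_R_matrix n \<epsilon> l m R \<longleftrightarrow>
     R \<in> lin_hom (WW n \<epsilon> l m) (WW n \<epsilon> l m) \<and>
     (\<forall>X\<in>carrier (UA n \<epsilon>). \<forall>g\<in>X. \<forall>v\<in>WW n \<epsilon> l m.
        pi_pi n \<epsilon> x_par y_par (Delta_op g) (R v) = R (pi_pi n \<epsilon> x_par y_par (Delta g) v)) \<and>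
     R (tens (ket (single_idx n l)) (ket (single_idx n m))) =
       tens (ket (single_idx n l)) (ket (single_idx n m))"

definition last_two :: "nat \<Rightarrow> nat \<Rightarrow> nat \<Rightarrow> midx" where
  "last_two n a b = (\<lambda>i. if i = n - 1 then a else if i = n then b else 0)"

definition xi :: "nat \<Rightarrow> nat \<Rightarrow> nat \<Rightarrow> nat \<Rightarrow> (midx \<times> midx \<Rightarrow>\<^sub>0 scal)" where
  "xi n l m s = (\<Sum>j = 0..s.
     ((- 1) ^ j * q_par powi (int j * (2 * int s - int m - int j - 1) + int m * int s) * qbinom s j)
       \<cdot>\<^sub>K tens (ket (last_two n j (l - j))) (ket (last_two n (s - j) (m - s + j))))"

definition is_P_op ::
  "nat \<Rightarrow> (nat \<Rightarrow> nat) \<Rightarrow> nat \<Rightarrow> nat \<Rightarrow> nat \<Rightarrow>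
    ((midx \<times> midx \<Rightarrow>\<^sub>0 scal) \<Rightarrow> (midx \<times> midx \<Rightarrow>\<^sub>0 scal)) \<Rightarrow> bool" where
  "is_P_op n \<epsilon> l m s T \<longleftrightarrow>
     T \<in> lin_hom (WW n \<epsilon> l m) (WW n \<epsilon> m l) \<and>
     (\<forall>s'\<le>min l m. T (xi n l m s') = (if s = s' then xi n m l s else 0)) \<and>
     (\<forall>X\<in>UA_bar n \<epsilon>. \<forall>g\<in>X. \<forall>v\<in>WW n \<epsilon> l m.
        pi_pi n \<epsilon> y_par x_par (Delta g) (T v) = T (pi_pi n \<epsilon> x_par y_par (Delta g) v))"

definition eps :: "nat \<Rightarrow> nat \<Rightarrow> nat" where
  "eps \<kappa> i = (if i \<le> \<kappa> then 1 else 0)"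

end

theory Submission
  imports Defs
begin

text \<open>
  Write \<open>T = P R\<close>. Reading the defining property of \<open>R\<close> through the flip, \<open>T\<close> intertwines the action of
  every generator on \<open>W\<^sub>l \<otimes> W\<^sub>m\<close> with parameters \<open>(x, y)\<close> and the action on \<open>W\<^sub>m \<otimes> W\<^sub>l\<close> with parameters
  \<open>(y, x)\<close>. The right-hand side of the decomposition does the same for the generators with index
  in \<open>{1..<n}\<close>. So the set where both sides agree is a subspace stable under \<open>f\<^sub>1, \<dots>, f\<^sub>n\<^sub>-\<^sub>1\<close>, and two
  things are to be shown: the singular vectors \<open>\<xi>\<^sub>s\<close> lie in it, and they generate everything.

  Eigenvalues (\<open>intertwiner_xi\<close>). Call the \<open>n\<close> components of a multi-index rows, and the units in them
  particles. The \<open>\<xi>\<^sub>s\<close> are supported on the last two rows, where the compositions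
  \<open>E0 = e\<^sub>n\<^sub>-\<^sub>2 \<dots> e\<^sub>0\<close> and \<open>F0 = f\<^sub>0 \<dots> f\<^sub>n\<^sub>-\<^sub>2\<close> act like affine rank one generators carrying the spectral
  parameters. Every vector on the last two rows with at most \<open>min l m\<close> particles in row \<open>n - 1\<close> arises
  from the vacuum, in which all particles are in row \<open>n\<close>, by \<open>f\<^sub>n\<^sub>-\<^sub>1\<close> and \<open>E0\<close>; so \<open>T\<close> maps such vectors
  to vectors of the same kind (\<open>intertwiner_level\<close>). There, up to scalars, \<open>\<xi>\<^sub>s\<close> is the only vector
  annihilated by \<open>e\<^sub>n\<^sub>-\<^sub>1\<close> with \<open>s\<close> particles in row \<open>n - 1\<close>
  (\<open>singular_unique\<close>); hence \<open>T \<xi>\<^sub>s = \<rho>\<^sub>s \<xi>\<^sub>s\<close> with the two \<open>\<xi>\<^sub>s\<close> taken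
  for \<open>(l, m)\<close> and \<open>(m, l)\<close>. Finally \<open>F0\<close> commutes with \<open>e\<^sub>n\<^sub>-\<^sub>1\<close>, so \<open>F0 \<xi>\<^sub>s = c\<^sub>s \<xi>\<^sub>s\<^sub>-\<^sub>1\<close> with
  \<open>c\<^sub>s = [s] (q\<^sup>l\<^sup>+\<^sup>m / y - q\<^sup>2\<^sup>s\<^sup>-\<^sup>2 / x)\<close> (\<open>F0_xi\<close>), and comparing \<open>T F0 \<xi>\<^sub>s\<close> with \<open>F0 T \<xi>\<^sub>s\<close> shows that \<open>\<rho>\<^sub>s / \<rho>\<^sub>s\<^sub>-\<^sub>1\<close> is
  \<open>c\<^sub>s\<close> divided by its image under the exchange of \<open>(x, l)\<close> and \<open>(y, m)\<close>; this is the \<open>s\<close>-th factor of the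
  product. The normalization gives \<open>\<rho>\<^sub>0 = 1\<close>.

  Generation (\<open>generated\<close>). On the last two rows the \<open>\<xi>\<^sub>s\<close> supply exactly what the image of \<open>f\<^sub>n\<^sub>-\<^sub>1\<close>
  misses among the vectors with at most \<open>min l m\<close> particles in row \<open>n - 1\<close>; this rests on a sum being
  nonzero, which follows from the positivity of all its terms at \<open>q\<^sup>1\<^sup>/\<^sup>2 = 1\<close> (\<open>pos_scal\<close>).
  The remaining rows are filled by the other \<open>f\<^sub>i\<close>, first in the right tensor factor and then in the
  left one.
\<close>

section \<open>Linear maps between free vector spaces\<close>

lemma lookup_smul [simp]: "Poly_Mapping.lookup (c \<cdot>\<^sub>K v) b = c * Poly_Mapping.lookup v b"
  by (simp add: smul_def Poly_Mapping.map.rep_eq when_def)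

global_interpretation smul: vector_space smul
  by standard (auto intro!: poly_mapping_eqI simp: lookup_add algebra_simps)

global_interpretation smul_pair: vector_space_pair smul smul
  by standard

abbreviation linear_map :: "(('b \<Rightarrow>\<^sub>0 scal) \<Rightarrow> ('c \<Rightarrow>\<^sub>0 scal)) \<Rightarrow> bool" where
  "linear_map \<equiv> Vector_Spaces.linear smul smul"

lemma linear_mapI:
  assumes "\<And>u v. f (u + v) = f u + f v" "\<And>c v. f (c \<cdot>\<^sub>K v) = c \<cdot>\<^sub>K f v"
  shows "linear_map f"
  by standard (use assms in \<open>auto simp: algebra_simps\<close>)

lemma linext_superset:
  assumes "finite S" "Poly_Mapping.keys v \<subseteq> S"
  shows "linext f v = (\<Sum>b\<in>S. Poly_Mapping.lookup v b \<cdot>\<^sub>K f b)"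
  unfolding linext_def by (rule sum.mono_neutral_left) (use assms in \<open>auto simp: in_keys_iff\<close>)

lemma linear_map_linext [intro]: "linear_map (linext f)"
proof (rule linear_mapI)
  fix u v :: "'a \<Rightarrow>\<^sub>0 scal" and c
  let ?S = "Poly_Mapping.keys u \<union> Poly_Mapping.keys v"
  have "Poly_Mapping.keys (u + v) \<subseteq> ?S"
    by (rule Poly_Mapping.keys_add)
  then show "linext f (u + v) = linext f u + linext f v"
    by (simp add: linext_superset[of ?S] lookup_add smul.scale_left_distrib sum.distrib)
  have "Poly_Mapping.keys (c \<cdot>\<^sub>K v) \<subseteq> Poly_Mapping.keys v"
    by (auto simp: in_keys_iff)
  then show "linext f (c \<cdot>\<^sub>K v) = c \<cdot>\<^sub>K linext f v"
    by (simp add: linext_superset[of "Poly_Mapping.keys v"] smul.scale_sum_right)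
qed

lemmas linext_add = linear_map_linext[THEN smul_pair.linear_add]
lemmas linext_smul = linear_map_linext[THEN smul_pair.linear_scale]
lemmas linext_zero = linear_map_linext[THEN smul_pair.linear_0]

lemma linext_ket [simp]: "linext f (ket b) = f b"
  by (simp add: linext_def ket_def)

lemma linext_expand:
  assumes "linear_map g"
  shows "g v = linext (\<lambda>b. g (ket b)) v"
proof -
  have "v = (\<Sum>b\<in>Poly_Mapping.keys v. Poly_Mapping.lookup v b \<cdot>\<^sub>K ket b)"
    by (rule poly_mapping_eqI)
       (auto simp: lookup_sum ket_def lookup_single when_def in_keys_iff if_distrib cong: if_cong)
  then have "g v = g (\<Sum>b\<in>Poly_Mapping.keys v. Poly_Mapping.lookup v b \<cdot>\<^sub>K ket b)"
    by simp
  then show ?thesis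
    using assms by (simp add: linext_def smul_pair.linear_sum smul_pair.linear_scale)
qed

lemma linear_map_eqI:
  assumes "linear_map f" "linear_map g" "\<And>b. b \<in> Poly_Mapping.keys v \<Longrightarrow> f (ket b) = g (ket b)"
  shows "f v = g v"
proof -
  have "linext (\<lambda>b. f (ket b)) v = linext (\<lambda>b. g (ket b)) v"
    using assms(3) by (simp add: linext_def)
  then show ?thesis
    using linext_expand[OF assms(1)] linext_expand[OF assms(2)] by metis
qed

text \<open>Membership of images in a subspace is a matter of basis vectors only; applied to the identity
  it gives spanning by kets.\<close>
lemma linear_map_subspaceI:
  assumes "linear_map f" "smul.subspace S" "\<And>b. b \<in> Poly_Mapping.keys v \<Longrightarrow> f (ket b) \<in> S"
  shows "f v \<in> S"
proof -
  have "linext (\<lambda>b. f (ket b)) v \<in> S"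
    using assms(2,3) by (auto simp: linext_def intro!: smul.subspace_sum smul.subspace_scale)
  then show ?thesis
    using linext_expand[OF assms(1)] by metis
qed

lemma tens_ket_ket [simp]: "tens (ket b) (ket c) = ket (b, c)"
  by (simp add: tens_def)

lemma tens_smul_left: "tens (a \<cdot>\<^sub>K u) v = a \<cdot>\<^sub>K tens u v"
  by (simp add: tens_def linext_smul)

lemma tens_zero_left [simp]: "tens 0 v = 0"
  by (simp add: tens_def linext_zero)

lemma tens_ket_smul_right: "tens (ket b) (a \<cdot>\<^sub>K v) = a \<cdot>\<^sub>K tens (ket b) v"
  by (simp add: tens_def linext_smul)

lemma tens_ket_zero_right [simp]: "tens (ket b) 0 = 0"
  by (simp add: tens_def linext_zero)

lemma tens_op_ket [simp]: "tens_op S T (ket (b, c)) = tens (S (ket b)) (T (ket c))"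
  by (simp add: tens_op_def)

lemma linear_map_tens_op [intro]: "linear_map (tens_op S T)"
  unfolding tens_op_def by (rule linear_map_linext)

lemma tens_swap_ket [simp]: "tens_swap (ket (b, c)) = ket (c, b)"
  by (simp add: tens_swap_def)

lemma linear_map_tens_swap [intro]: "linear_map tens_swap"
  unfolding tens_swap_def by (rule linear_map_linext)

lemma lookup_ket: "Poly_Mapping.lookup (ket b) c = (if b = c then 1 else 0)"
  by (simp add: ket_def lookup_single when_def)

section \<open>Positive scalars and genericity\<close>

definition lift_scal :: "complex poly \<Rightarrow> scal" where
  "lift_scal p = Fract [:[:p:]:] 1"

lemma lift_scal_mult: "lift_scal (a * b) = lift_scal a * lift_scal b"
  by (simp add: lift_scal_def)

lemma lift_scal_add: "lift_scal (a + b) = lift_scal a + lift_scal b"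
  by (simp add: lift_scal_def)

lemma lift_scal_1: "lift_scal 1 = 1"
  by (simp add: lift_scal_def One_fract_def one_pCons)

lemma lift_scal_eq_0_iff [simp]: "lift_scal a = 0 \<longleftrightarrow> a = 0"
  by (simp add: lift_scal_def Zero_fract_def eq_fract)

lemma lift_scal_eq_iff: "lift_scal a = lift_scal b \<longleftrightarrow> a = b"
  by (simp add: lift_scal_def eq_fract)

text \<open>Several rational expressions in \<open>q\<^sup>1\<^sup>/\<^sup>2\<close> must be shown to be nonzero, among them a sum without an
  obvious closed form. Specialising \<open>q\<^sup>1\<^sup>/\<^sup>2\<close> to \<open>1\<close> would do, but is only a partial map on the field; the
  fractions whose numerator and denominator both have positive value at \<open>1\<close> form a subsemifield
  that avoids \<open>0\<close>, and closure properties replace the specialisation.\<close>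
definition pos_scal :: "scal set" where
  "pos_scal = {lift_scal a / lift_scal b | a b.
     \<exists>r s. 0 < r \<and> 0 < s \<and> poly a 1 = complex_of_real r \<and> poly b 1 = complex_of_real s}"

lemma pos_scalE:
  assumes "u \<in> pos_scal"
  obtains a b r s where "u = lift_scal a / lift_scal b" "0 < r" "0 < s"
    "poly a 1 = complex_of_real r" "poly b 1 = complex_of_real s" "lift_scal a \<noteq> 0" "lift_scal b \<noteq> 0"
  using assms unfolding pos_scal_def by fastforce

lemma pos_scalI:
  assumes "u = lift_scal a / lift_scal b" "0 < r" "0 < s"
    "poly a 1 = complex_of_real r" "poly b 1 = complex_of_real s"
  shows "u \<in> pos_scal"
  unfolding pos_scal_def using assms by blast

lemma pos_scal_nonzero: "u \<in> pos_scal \<Longrightarrow> u \<noteq> 0"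
  by (erule pos_scalE) simp

lemma pos_scal_1: "1 \<in> pos_scal"
  by (rule pos_scalI[of _ 1 1 1 1]) (simp_all add: lift_scal_1)

lemma pos_scal_mult:
  assumes "u \<in> pos_scal" "v \<in> pos_scal"
  shows "u * v \<in> pos_scal"
proof -
  obtain a b r s where 1: "u = lift_scal a / lift_scal b" "0 < r" "0 < s"
    "poly a 1 = complex_of_real r" "poly b 1 = complex_of_real s"
    using assms(1) by (rule pos_scalE)
  obtain a' b' r' s' where 2: "v = lift_scal a' / lift_scal b'" "0 < r'" "0 < s'"
    "poly a' 1 = complex_of_real r'" "poly b' 1 = complex_of_real s'"
    using assms(2) by (rule pos_scalE)
  show ?thesis
    by (rule pos_scalI[of _ "a * a'" "b * b'" "r * r'" "s * s'"]) (use 1 2 in \<open>simp_all add: lift_scal_mult\<close>)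
qed

lemma pos_scal_add:
  assumes "u \<in> pos_scal" "v \<in> pos_scal"
  shows "u + v \<in> pos_scal"
proof -
  obtain a b r s where 1: "u = lift_scal a / lift_scal b" "0 < r" "0 < s"
    "poly a 1 = complex_of_real r" "poly b 1 = complex_of_real s" "lift_scal b \<noteq> 0"
    using assms(1) by (rule pos_scalE)
  obtain a' b' r' s' where 2: "v = lift_scal a' / lift_scal b'" "0 < r'" "0 < s'"
    "poly a' 1 = complex_of_real r'" "poly b' 1 = complex_of_real s'" "lift_scal b' \<noteq> 0"
    using assms(2) by (rule pos_scalE)
  have "u + v = lift_scal (a * b' + a' * b) / lift_scal (b * b')"
    unfolding 1(1) 2(1) add_frac_eq[OF 1(6) 2(6)] by (simp add: lift_scal_mult lift_scal_add)
  then show ?thesis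
    by (rule pos_scalI[of _ _ _ "r * s' + r' * s" "s * s'"]) (use 1 2 in \<open>simp_all add: add_pos_pos\<close>)
qed

lemma pos_scal_inverse:
  assumes "u \<in> pos_scal"
  shows "inverse u \<in> pos_scal"
proof -
  obtain a b r s where 1: "u = lift_scal a / lift_scal b" "0 < r" "0 < s"
    "poly a 1 = complex_of_real r" "poly b 1 = complex_of_real s"
    using assms(1) by (rule pos_scalE)
  show ?thesis
    by (rule pos_scalI[of _ b a s r]) (use 1 in simp_all)
qed

lemma pos_scal_divide: "u \<in> pos_scal \<Longrightarrow> v \<in> pos_scal \<Longrightarrow> u / v \<in> pos_scal"
  unfolding divide_inverse by (intro pos_scal_mult pos_scal_inverse)

lemma pos_scal_power: "u \<in> pos_scal \<Longrightarrow> u ^ n \<in> pos_scal"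
  by (induction n) (auto intro: pos_scal_mult pos_scal_1)

lemma pos_scal_powi: "u \<in> pos_scal \<Longrightarrow> u powi i \<in> pos_scal"
  by (auto simp: power_int_def intro: pos_scal_power pos_scal_inverse)

lemma pos_scal_prod: "(\<And>i. i \<in> I \<Longrightarrow> f i \<in> pos_scal) \<Longrightarrow> prod f I \<in> pos_scal"
  by (induction I rule: infinite_finite_induct) (auto intro: pos_scal_mult pos_scal_1)

lemma pos_scal_sum:
  "finite I \<Longrightarrow> I \<noteq> {} \<Longrightarrow> (\<And>i. i \<in> I \<Longrightarrow> f i \<in> pos_scal) \<Longrightarrow> sum f I \<in> pos_scal"
  by (induction I rule: finite_ne_induct) (auto intro: pos_scal_add)

lemma q_par_eq: "q_par = lift_scal [:0, 0, 1:]"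
  by (simp add: q_par_def q_half_def lift_scal_def power2_eq_square)

lemma pos_scal_q [simp]: "q_par \<in> pos_scal"
  by (rule pos_scalI[of _ "[:0, 0, 1:]" 1 1 1]) (simp_all add: q_par_eq lift_scal_1)

lemma q_par_nonzero [simp]: "q_par \<noteq> 0"
  using pos_scal_q pos_scal_nonzero by blast

lemma pos_scal_q_powi [simp]: "q_par powi i \<in> pos_scal"
  by (intro pos_scal_powi pos_scal_q)

lemma q_diff_nonzero: "q_par - inverse q_par \<noteq> 0"
proof
  assume "q_par - inverse q_par = 0"
  then have "q_par * q_par = 1"
    by (simp add: field_simps)
  then have "lift_scal ([:0, 0, 1:] * [:0, 0, 1:]) = lift_scal 1"
    by (simp only: lift_scal_mult lift_scal_1 flip: q_par_eq)
  then show False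
    by (simp only: lift_scal_eq_iff) (simp add: one_pCons)
qed

lemma qint_0 [simp]: "qint 0 = 0"
  by (simp add: qint_def)

lemma qint_1 [simp]: "qint (Suc 0) = 1"
  using q_diff_nonzero by (simp add: qint_def)

lemma qint_Suc: "qint (Suc m) = q_par * qint m + q_par powi (- int m)"
proof -
  define A where "A = q_par ^ m"
  have "A \<noteq> 0"
    by (simp add: A_def)
  have *: "q_par powi int m = A" "q_par powi (- int m) = inverse A"
    "q_par powi int (Suc m) = q_par * A" "q_par powi (- int (Suc m)) = inverse (q_par * A)"
    by (simp_all only: power_int_minus power_int_of_nat A_def power_Suc)
  show ?thesis
    unfolding qint_def * using q_diff_nonzero \<open>A \<noteq> 0\<close> by (simp add: field_simps)
qed

lemma pos_scal_qint: "0 < m \<Longrightarrow> qint m \<in> pos_scal"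
proof (induction m)
  case (Suc m)
  then show ?case
    by (cases "m = 0") (auto simp: qint_Suc pos_scal_1 intro!: pos_scal_add pos_scal_mult)
qed simp

lemma qint_eq_0_iff [simp]: "qint m = 0 \<longleftrightarrow> m = 0"
  using pos_scal_qint[of m] pos_scal_nonzero by (cases "m = 0") auto

lemma qfact_nonzero [simp]: "qfact m \<noteq> 0"
  by (simp add: qfact_def)

lemma pos_scal_qfact: "qfact m \<in> pos_scal"
  unfolding qfact_def by (intro pos_scal_prod pos_scal_qint) simp

lemma qfact_Suc: "qfact (Suc m) = qint (Suc m) * qfact m"
  by (simp add: qfact_def)

lemma x_par_nonzero [simp]: "x_par \<noteq> 0"
  by (simp add: x_par_def Zero_fract_def eq_fract)

lemma y_par_nonzero [simp]: "y_par \<noteq> 0"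
  by (simp add: y_par_def Zero_fract_def eq_fract)

text \<open>Positivity yields nonzero numerator and denominator for a power of \<open>q\<close>, and after
  clearing the denominator one side is divisible by \<open>y\<close> while the other is nonzero and free of \<open>y\<close>.\<close>
lemma x_par_y_par_generic:
  "x_par * q_par powi i \<noteq> y_par * q_par powi j"
proof
  assume eq: "x_par * q_par powi i = y_par * q_par powi j"
  obtain a b r s where *: "q_par powi (i - j) = lift_scal a / lift_scal b"
    "lift_scal a \<noteq> 0" "lift_scal b \<noteq> 0"
    using pos_scalE[OF pos_scal_q_powi] by metis
  have "q_par powi i = q_par powi (i - j) * q_par powi j"
    by (simp flip: power_int_add)
  then have "x_par * lift_scal a = y_par * lift_scal b"
    using eq * by (simp add: field_simps)
  then have "[:[:0, 1:]:] * [:[:a:]:] = [:0, 1:] * [:[:b:]:]"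
    by (simp add: x_par_def y_par_def lift_scal_def eq_fract)
  then show False
    using * by simp
qed

section \<open>Tensor products, coproducts and the two algebras\<close>
lemma tens_swap_swap [simp]: "tens_swap (tens_swap v) = v"
proof -
  have "tens_swap (tens_swap v) = id v"
    by (rule linear_map_eqI[OF
          Vector_Spaces.linear_compose[OF linear_map_tens_swap linear_map_tens_swap, unfolded comp_def]
          smul.linear_id]) auto
  then show ?thesis by simp
qed

lemma linear_map_tens_left: "linear_map (\<lambda>u. tens u w)"
  unfolding tens_def by (rule linear_map_linext)

lemma linear_map_tens_right: "linear_map (\<lambda>w. tens u w)"
  by (rule linear_mapI)
     (simp_all add: tens_def linext_def[of _ u] linext_add linext_smul smul.scale_right_distrib
       sum.distrib smul.scale_sum_right mult.commute)

lemma tens_swap_tens [simp]: "tens_swap (tens u w) = tens w u"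
proof -
  have *: "tens_swap (tens (ket b) w) = tens w (ket b)" for b
    by (rule linear_map_eqI[OF Vector_Spaces.linear_compose[OF linear_map_tens_right linear_map_tens_swap, unfolded comp_def]
          linear_map_tens_left]) simp
  show ?thesis
    by (rule linear_map_eqI[OF Vector_Spaces.linear_compose[OF linear_map_tens_left linear_map_tens_swap, unfolded comp_def]
          linear_map_tens_right]) (rule *)
qed

lemma linear_map_pi_pi: "linear_map (pi_pi n \<epsilon> x y h)"
proof (rule linear_mapI)
  have lin: "linear_map (case a of (u, w) \<Rightarrow> tens_op (pi_word n \<epsilon> x u) (pi_word n \<epsilon> y w))" for a
    by (cases a) auto
  have eq: "pi_pi n \<epsilon> x y h v = (\<Sum>a\<in>Poly_Mapping.keys h. Poly_Mapping.lookup h a \<cdot>\<^sub>K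
    (case a of (u, w) \<Rightarrow> tens_op (pi_word n \<epsilon> x u) (pi_word n \<epsilon> y w)) v)" for v
    unfolding pi_pi_def linext_def by (intro sum.cong) (auto split: prod.split)
  show "pi_pi n \<epsilon> x y h (u + v) = pi_pi n \<epsilon> x y h u + pi_pi n \<epsilon> x y h v" for u v
    unfolding eq smul_pair.linear_add[OF lin] by (simp add: smul.scale_right_distrib sum.distrib)
  show "pi_pi n \<epsilon> x y h (c \<cdot>\<^sub>K v) = c \<cdot>\<^sub>K pi_pi n \<epsilon> x y h v" for c v
    unfolding eq smul_pair.linear_scale[OF lin] by (simp add: smul.scale_sum_right mult.commute)
qed

lemma linear_map_pi_pi_alg: "linear_map (\<lambda>h. pi_pi n \<epsilon> x y h v)"
  unfolding pi_pi_def by (rule linear_map_linext)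

lemma pi_pi_ket: "pi_pi n \<epsilon> x y (ket (u, w)) v = tens_op (pi_word n \<epsilon> x u) (pi_word n \<epsilon> y w) v"
  by (simp add: pi_pi_def)

text \<open>Turns the intertwining property of \<open>R\<close> for the opposite coproduct into one of \<open>P R\<close> for the
  coproduct itself, with the two spectral parameters exchanged.\<close>
lemma pi_pi_swap:
  "tens_swap (pi_pi n \<epsilon> x y (tens_swap h) v) = pi_pi n \<epsilon> y x h (tens_swap v)"
proof -
  have *: "tens_swap (tens_op S T v) = tens_op T S (tens_swap v)" for S T
    by (rule linear_map_eqI[OF
          Vector_Spaces.linear_compose[OF linear_map_tens_op linear_map_tens_swap, unfolded comp_def]
          Vector_Spaces.linear_compose[OF linear_map_tens_swap linear_map_tens_op, unfolded comp_def]]) auto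
  show ?thesis
    by (rule linear_map_eqI[OF
          Vector_Spaces.linear_compose[OF linear_map_tens_swap
            Vector_Spaces.linear_compose[OF linear_map_pi_pi_alg linear_map_tens_swap], unfolded comp_def]
          linear_map_pi_pi_alg]) (auto simp: pi_pi_ket *)
qed

lemma one_word_eq_ket: "(1 :: word \<Rightarrow>\<^sub>0 scal) = ket 0"
  by (simp add: ket_def)

lemma pi_word_zero [simp]: "pi_word n \<epsilon> x 0 v = v"
  by (simp add: pi_word_def zero_word_def)

lemma pi_word_letter [simp]: "pi_word n \<epsilon> x (Word [g]) v = linext (pi_gen n \<epsilon> x g) v"
  by (simp add: pi_word_def)

lemma Delta_emb: "Delta (emb g) = Delta_gen g"
  by (simp add: Delta_def emb_def)

lemma emb_mem_free_carrier: "gen_index g \<in> J \<Longrightarrow> emb g \<in> free_carrier J"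
  by (simp add: free_carrier_def emb_def ket_def)

text \<open>Intertwining is assumed for all representatives of all elements of the quotient algebra, so it
  holds for every generator once the generator is seen to lie in its own coset.\<close>
lemma mem_coset_self:
  assumes "a \<in> free_carrier J"
  shows "a \<in> UA_ideal n \<epsilon> +>\<^bsub>free_alg {..<n}\<^esub> a"
proof -
  have "\<zero>\<^bsub>free_alg {..<n}\<^esub> \<in> UA_ideal n \<epsilon>"
    unfolding UA_ideal_def genideal_def
    by (auto intro: additive_subgroup.zero_closed dest: ideal.axioms(1))
  then show ?thesis
    unfolding a_r_coset_def r_coset_def by (force simp: free_alg_def)
qed

lemma emb_mem_UA:
  assumes "gen_index g < n"
  shows "\<exists>X\<in>carrier (UA n \<epsilon>). emb g \<in> X"
proof -
  have "emb g \<in> free_carrier {..<n}"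
    using assms by (intro emb_mem_free_carrier) simp
  then show ?thesis
    by (intro bexI[of _ "UA_ideal n \<epsilon> +>\<^bsub>free_alg {..<n}\<^esub> emb g"] mem_coset_self)
       (auto simp: UA_def FactRing_def A_RCOSETS_def RCOSETS_def a_r_coset_def free_alg_def)
qed

lemma emb_mem_UA_bar:
  assumes "gen_index g \<in> {1..<n}"
  shows "\<exists>X\<in>UA_bar n \<epsilon>. emb g \<in> X"
  using emb_mem_free_carrier[OF assms] mem_coset_self unfolding UA_bar_def by blast

section \<open>Generators on tensor products\<close>

lemma sum_shift:
  assumes "finite I" "a \<in> I" "b \<in> I" "a \<noteq> b" "0 < p a"
  shows "(\<Sum>i\<in>I. shift a b p i) = (\<Sum>i\<in>I. p i)"
proof -
  have 1: "(\<Sum>i\<in>I. f i) = f a + (f b + (\<Sum>i\<in>I - {a} - {b}. f i))" for f :: "nat \<Rightarrow> nat"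
    using assms by (simp add: sum.remove[of I a] sum.remove[of "I - {a}" b])
  show ?thesis
    unfolding 1 using assms by (auto simp: shift_def)
qed

text \<open>The bound on \<open>\<kappa>\<close> makes the last two rows bosonic; these are the rows that support the
  vectors \<open>xi\<close>.\<close>
locale rows =
  fixes n \<kappa> :: nat
  assumes n_ge_2: "2 \<le> n" and kappa_le: "\<kappa> \<le> n - 2"
begin

definition act :: "scal \<Rightarrow> scal \<Rightarrow> gen \<Rightarrow> (midx \<times> midx \<Rightarrow>\<^sub>0 scal) \<Rightarrow> (midx \<times> midx \<Rightarrow>\<^sub>0 scal)" where
  "act x y g = pi_pi n (eps \<kappa>) x y (Delta (emb g))"

text \<open>Images that leave the allowed multi-indices (a second particle on a \<open>V\<close> factor) vanish.\<close>
definition ket2_in :: "midx \<Rightarrow> midx \<Rightarrow> (midx \<times> midx \<Rightarrow>\<^sub>0 scal)" where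
  "ket2_in p r = (if p \<in> midxs n (eps \<kappa>) \<and> r \<in> midxs n (eps \<kappa>) then ket (p, r) else 0)"

lemma linear_map_act: "linear_map (act x y g)"
  unfolding act_def by (rule linear_map_pi_pi)

lemmas act_add = linear_map_act[THEN smul_pair.linear_add]
lemmas act_smul = linear_map_act[THEN smul_pair.linear_scale]
lemmas act_sum = linear_map_act[THEN smul_pair.linear_sum]

lemma act_e_ket:
  assumes "p \<in> midxs n (eps \<kappa>)" "r \<in> midxs n (eps \<kappa>)"
  shows "act x y (Gen_e i) (ket (p, r)) =
    ((if i = 0 then y else 1) * qint (r (cyc n i))) \<cdot>\<^sub>K ket2_in p (shift (cyc n i) (cyc n (i + 1)) r) +
    ((if i = 0 then x else 1) * qint (p (cyc n i)) * k_eigval n (eps \<kappa>) i r) \<cdot>\<^sub>K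
      ket2_in (shift (cyc n i) (cyc n (i + 1)) p) r"
  using assms
  unfolding act_def Delta_emb Delta_gen.simps unfolding emb_def one_word_eq_ket
  by (auto simp: smul_pair.linear_add[OF linear_map_pi_pi_alg]
      pi_pi_ket ket2_in_def ket_in_def tens_smul_left tens_ket_smul_right)

lemma act_f_ket:
  assumes "p \<in> midxs n (eps \<kappa>)" "r \<in> midxs n (eps \<kappa>)"
  shows "act x y (Gen_f i) (ket (p, r)) =
    ((if i = 0 then inverse x else 1) * qint (p (cyc n (i + 1)))) \<cdot>\<^sub>K
      ket2_in (shift (cyc n (i + 1)) (cyc n i) p) r +
    (inverse (k_eigval n (eps \<kappa>) i p) * (if i = 0 then inverse y else 1) * qint (r (cyc n (i + 1)))) \<cdot>\<^sub>K
      ket2_in p (shift (cyc n (i + 1)) (cyc n i) r)"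
  using assms
  unfolding act_def Delta_emb Delta_gen.simps unfolding emb_def one_word_eq_ket
  by (auto simp: smul_pair.linear_add[OF linear_map_pi_pi_alg]
      pi_pi_ket ket2_in_def ket_in_def tens_smul_left tens_ket_smul_right)

lemma subspace_WW: "smul.subspace (WW n (eps \<kappa>) l m)"
proof (rule smul.subspaceI)
  fix u v c assume "u \<in> WW n (eps \<kappa>) l m" "v \<in> WW n (eps \<kappa>) l m"
  moreover have "Poly_Mapping.keys (c \<cdot>\<^sub>K u) \<subseteq> Poly_Mapping.keys u"
    by (auto simp: in_keys_iff)
  ultimately show "u + v \<in> WW n (eps \<kappa>) l m" "c \<cdot>\<^sub>K u \<in> WW n (eps \<kappa>) l m"
    using Poly_Mapping.keys_add[of u v] unfolding WW_def by blast+
qed (simp add: WW_def)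

lemma ket_in_WW_iff:
  "ket (p, r) \<in> WW n (eps \<kappa>) l m \<longleftrightarrow> p \<in> midxs_deg n (eps \<kappa>) l \<and> r \<in> midxs_deg n (eps \<kappa>) m"
  by (simp add: WW_def ket_def)

lemma cyc_mem: "cyc n i \<in> {1..n}"
  using n_ge_2 by (auto simp: cyc_def Suc_le_eq intro: less_imp_le)

lemma cyc_small: "0 < i \<Longrightarrow> i \<le> n \<Longrightarrow> cyc n i = i"
  by (auto simp: cyc_def le_less)

lemma cyc_0: "cyc n 0 = n"
  by (simp add: cyc_def)

lemma cyc_Suc_neq: "i < n \<Longrightarrow> cyc n (i + 1) \<noteq> cyc n i"
  using n_ge_2 by (cases "i = 0") (simp_all add: cyc_small cyc_0)

lemma shift_mem_deg:
  assumes "p \<in> midxs_deg n (eps \<kappa>) l" "a \<in> {1..n}" "b \<in> {1..n}" "a \<noteq> b" "0 < p a"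
    "shift a b p \<in> midxs n (eps \<kappa>)"
  shows "shift a b p \<in> midxs_deg n (eps \<kappa>) l"
  using assms sum_shift[of "{1..n}" a b p] unfolding midxs_deg_def by auto

lemma act_mem_WW_aux:
  assumes "p \<in> midxs_deg n (eps \<kappa>) l" "r \<in> midxs_deg n (eps \<kappa>) m"
    "a \<in> {1..n}" "b \<in> {1..n}" "a \<noteq> b"
  shows "(c * qint (p a) * d) \<cdot>\<^sub>K ket2_in (shift a b p) r \<in> WW n (eps \<kappa>) l m"
    "(c * qint (r a)) \<cdot>\<^sub>K ket2_in p (shift a b r) \<in> WW n (eps \<kappa>) l m"
proof -
  show "(c * qint (p a) * d) \<cdot>\<^sub>K ket2_in (shift a b p) r \<in> WW n (eps \<kappa>) l m"
    using assms smul.subspace_0[OF subspace_WW]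
    by (cases "p a = 0")
       (auto simp: ket2_in_def ket_in_WW_iff intro!: smul.subspace_scale[OF subspace_WW] shift_mem_deg)
  show "(c * qint (r a)) \<cdot>\<^sub>K ket2_in p (shift a b r) \<in> WW n (eps \<kappa>) l m"
    using assms smul.subspace_0[OF subspace_WW]
    by (cases "r a = 0")
       (auto simp: ket2_in_def ket_in_WW_iff intro!: smul.subspace_scale[OF subspace_WW] shift_mem_deg)
qed

lemma act_mem_WW:
  assumes "gen_index g < n" "v \<in> WW n (eps \<kappa>) l m"
    and g: "\<exists>i. g = Gen_e i \<or> g = Gen_f i"
  shows "act x y g v \<in> WW n (eps \<kappa>) l m"
proof (rule linear_map_subspaceI[OF linear_map_act subspace_WW])
  fix b assume "b \<in> Poly_Mapping.keys v"
  then obtain p r where b: "b = (p, r)"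
    and pr: "p \<in> midxs_deg n (eps \<kappa>) l" "r \<in> midxs_deg n (eps \<kappa>) m"
    using assms by (auto simp: WW_def)
  then have pr': "p \<in> midxs n (eps \<kappa>)" "r \<in> midxs n (eps \<kappa>)"
    by (auto simp: midxs_deg_def)
  obtain i where "i < n" and g': "g = Gen_e i \<or> g = Gen_f i"
    using assms by auto
  note c = cyc_mem[of i] cyc_mem[of "i + 1"] cyc_Suc_neq[OF \<open>i < n\<close>] cyc_Suc_neq[OF \<open>i < n\<close>, symmetric]
  show "act x y g (ket b) \<in> WW n (eps \<kappa>) l m"
    using g' act_mem_WW_aux[OF pr c(1,2,4)] act_mem_WW_aux[OF pr c(2,1,3)]
      act_mem_WW_aux(1)[OF pr c(2,1,3), where d = 1]
    by (auto simp only: b act_e_ket[OF pr'] act_f_ket[OF pr'] mult_1_right intro!: smul.subspace_add[OF subspace_WW])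
qed

lemma R_matrix_intertwines:
  assumes "is_R_matrix n (eps \<kappa>) l m R" "gen_index g < n" "v \<in> WW n (eps \<kappa>) l m"
  shows "tens_swap (R (act x_par y_par g v)) = act y_par x_par g (tens_swap (R v))"
proof -
  obtain X where "X \<in> carrier (UA n (eps \<kappa>))" "emb g \<in> X"
    using emb_mem_UA[OF assms(2)] by blast
  then have "pi_pi n (eps \<kappa>) x_par y_par (Delta_op (emb g)) (R v) = R (act x_par y_par g v)"
    using assms(1,3) unfolding is_R_matrix_def act_def by blast
  then show ?thesis
    by (simp add: act_def Delta_op_def flip: pi_pi_swap)
qed

lemma P_op_intertwines:
  assumes "is_P_op n (eps \<kappa>) l m s T" "gen_index g \<in> {1..<n}" "v \<in> WW n (eps \<kappa>) l m"
  shows "T (act x_par y_par g v) = act y_par x_par g (T v)"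
proof -
  obtain X where "X \<in> UA_bar n (eps \<kappa>)" "emb g \<in> X"
    using emb_mem_UA_bar[OF assms(2)] by blast
  then show ?thesis
    using assms(1,3) unfolding is_P_op_def act_def by auto
qed

end

lemma q_powi_diff: "q_par powi (a - b) = q_par powi (- b) * q_par powi a"
proof -
  have "a - b = - b + a" by simp
  then show ?thesis
    by (simp only: power_int_add q_par_nonzero simp_thms)
qed

context rows
begin

section \<open>The last two rows\<close>

abbreviation row2 :: "nat \<Rightarrow> nat \<Rightarrow> midx" where
  "row2 \<equiv> last_two n"

text \<open>A particle that travels between the last two rows by way of the first \<open>n - 2\<close> ones is recorded
  as an extra unit on top of a multi-index supported on the last two.\<close>
definition add_at :: "nat \<Rightarrow> midx \<Rightarrow> midx" where
  "add_at i p = p(i := p i + 1)"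

lemma eps_last [simp]: "eps \<kappa> n = 0" "eps \<kappa> (n - 1) = 0" "eps \<kappa> (n - Suc 0) = 0"
  using n_ge_2 kappa_le by (auto simp: eps_def)

lemma row2_mem [simp]: "row2 a c \<in> midxs n (eps \<kappa>)"
  using n_ge_2 kappa_le by (auto simp: midxs_def last_two_def eps_def)

lemma row2_mem_deg: "row2 a c \<in> midxs_deg n (eps \<kappa>) l \<longleftrightarrow> a + c = l"
proof -
  obtain k where k: "n = Suc (Suc k)"
    using n_ge_2 by (metis add_2_eq_Suc le_Suc_ex)
  have "(\<Sum>i = 1..k. row2 a c i) = 0"
    by (rule sum.neutral) (auto simp: last_two_def k)
  then have "(\<Sum>i = 1..n. row2 a c i) = a + c"
    by (simp add: k) (simp add: last_two_def)
  then show ?thesis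
    by (auto simp: midxs_deg_def)
qed

lemma add_at_row2_mem [simp]: "i \<in> {1..n} \<Longrightarrow> add_at i (row2 a c) \<in> midxs n (eps \<kappa>)"
  using n_ge_2 kappa_le by (auto simp: midxs_def last_two_def eps_def add_at_def)

lemma shift_add_at: "i \<noteq> j \<Longrightarrow> shift i j (add_at i p) = add_at j p"
  by (auto simp: shift_def add_at_def)

lemma shift_row2:
  "i \<noteq> n - 1 \<Longrightarrow> shift (n - 1) i (row2 a c) = add_at i (row2 (a - 1) c)"
  "i \<noteq> n \<Longrightarrow> shift n i (row2 a c) = add_at i (row2 a (c - 1))"
  using n_ge_2 by (auto simp: shift_def add_at_def last_two_def)

lemma add_at_row2: "add_at (n - 1) (row2 a c) = row2 (a + 1) c" "add_at n (row2 a c) = row2 a (c + 1)"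
  using n_ge_2 by (auto simp: add_at_def last_two_def)

lemma row2_apply: "row2 a c n = c" "row2 a c (n - 1) = a" "i < n - 1 \<Longrightarrow> row2 a c i = 0"
  using n_ge_2 by (auto simp: last_two_def)

lemma add_at_apply: "add_at i p i = p i + 1" "j \<noteq> i \<Longrightarrow> add_at i p j = p j"
  by (auto simp: add_at_def)

lemma q_idx_last: "i = n \<or> i = n - 1 \<or> i = 0 \<Longrightarrow> q_idx n (eps \<kappa>) i = q_par"
  using n_ge_2 cyc_small[of n] cyc_small[of "n - 1"] cyc_0 by (auto simp: q_idx_def)

lemma k_eigval_row2:
  "k_eigval n (eps \<kappa>) (n - 1) (row2 a c) = q_par powi (int c - int a)"
  "0 < i \<Longrightarrow> i < n - 2 \<Longrightarrow> k_eigval n (eps \<kappa>) i (row2 a c) = 1"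
  "2 < n \<Longrightarrow> k_eigval n (eps \<kappa>) (n - 2) (row2 a c) = q_par powi int a"
  "2 < n \<Longrightarrow> k_eigval n (eps \<kappa>) 0 (row2 a c) = q_par powi (- int c)"
  "n = 2 \<Longrightarrow> k_eigval n (eps \<kappa>) 0 (row2 a c) = q_par powi (int a - int c)"
proof -
  have n: "n - 1 + 1 = n" "n - 2 + 1 = n - 1"
    using n_ge_2 by auto
  show "k_eigval n (eps \<kappa>) (n - 1) (row2 a c) = q_par powi (int c - int a)"
    using n_ge_2 unfolding k_eigval_def n q_powi_diff
    by (simp add: cyc_small row2_apply[unfolded One_nat_def] q_idx_last)
  show "k_eigval n (eps \<kappa>) i (row2 a c) = 1" if "0 < i" "i < n - 2"
    using that n_ge_2 by (simp add: k_eigval_def cyc_small row2_apply)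
  show "k_eigval n (eps \<kappa>) (n - 2) (row2 a c) = q_par powi int a" if "2 < n"
    using that unfolding k_eigval_def n by (simp add: cyc_small row2_apply[unfolded One_nat_def] q_idx_last)
  show "k_eigval n (eps \<kappa>) 0 (row2 a c) = q_par powi (- int c)" if "2 < n"
    using that unfolding k_eigval_def by (simp add: cyc_small cyc_0 row2_apply[unfolded One_nat_def] q_idx_last)
  show "k_eigval n (eps \<kappa>) 0 (row2 a c) = q_par powi (int a - int c)" if "n = 2"
  proof -
    have "q_idx n (eps \<kappa>) 0 = q_par" "q_idx n (eps \<kappa>) (0 + 1) = q_par" "cyc n 0 = n" "cyc n (0 + 1) = n - 1"
      using that q_idx_last[of 0] q_idx_last[of 1] by (simp_all add: cyc_def)
    then show ?thesis
      unfolding k_eigval_def q_powi_diff by (simp add: row2_apply[unfolded One_nat_def])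
  qed
qed

abbreviation row_ket :: "nat \<Rightarrow> nat \<Rightarrow> nat \<Rightarrow> nat \<Rightarrow> (midx \<times> midx \<Rightarrow>\<^sub>0 scal)" where
  "row_ket a c b d \<equiv> ket (row2 a c, row2 b d)"

lemma act_f_last:
  "act x y (Gen_f (n - 1)) (row_ket a c b d) =
    qint c \<cdot>\<^sub>K row_ket (a + 1) (c - 1) b d + (q_par powi (int a - int c) * qint d) \<cdot>\<^sub>K row_ket a c (b + 1) (d - 1)"
proof -
  have n: "n - 1 + 1 = n" "0 < n - 1" "n - 1 \<le> n" "0 < n" "n - 1 \<noteq> n" "n - 1 \<noteq> 0"
    using n_ge_2 by auto
  have k: "inverse (q_par powi (int c - int a)) = q_par powi (int a - int c)"
    by (simp flip: power_int_minus)
  show ?thesis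
    unfolding act_f_ket[OF row2_mem row2_mem] n(1) cyc_small[OF n(2,3)] cyc_small[OF n(4) order_refl]
      shift_row2(2)[OF n(5)] add_at_row2 row2_apply k_eigval_row2 k
    using n(6) by (simp add: ket2_in_def)
qed

lemma act_e_last:
  "act x y (Gen_e (n - 1)) (row_ket a c b d) =
    qint b \<cdot>\<^sub>K row_ket a c (b - 1) (d + 1) + (qint a * q_par powi (int d - int b)) \<cdot>\<^sub>K row_ket (a - 1) (c + 1) b d"
proof -
  have n: "n - 1 + 1 = n" "0 < n - 1" "n - 1 \<le> n" "0 < n" "n \<noteq> n - 1" "n - 1 \<noteq> 0"
    using n_ge_2 by auto
  show ?thesis
    unfolding act_e_ket[OF row2_mem row2_mem] n(1) cyc_small[OF n(2,3)] cyc_small[OF n(4) order_refl]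
      shift_row2(1)[OF n(5)] add_at_row2 row2_apply k_eigval_row2
    using n(6) by (simp add: ket2_in_def)
qed

text \<open>For \<open>n = 2\<close> these are \<open>e\<^sub>0\<close> and \<open>f\<^sub>0\<close>. In general the chain \<open>e\<^sub>0, e\<^sub>1, \<dots>, e\<^sub>n\<^sub>-\<^sub>2\<close> carries one particle from
  row \<open>n\<close> through the rows \<open>1, 2, \<dots>\<close> to row \<open>n - 1\<close>, and the second chain carries it back.
  On the last two rows they act like the affine generators of the rank one quantum group, and they
  are where the spectral parameters enter.\<close>
definition E0 where "E0 x y v = fold (\<lambda>i. act x y (Gen_e i)) [0..<n - 1] v"
definition F0 where "F0 x y v = foldr (\<lambda>i. act x y (Gen_f i)) [0..<n - 1] v"

lemma act_e_0:
  "act x y (Gen_e 0) (row_ket a c b d) = (y * qint d) \<cdot>\<^sub>K ket (row2 a c, add_at 1 (row2 b (d - 1))) +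
    (x * qint c * (q_par powi (- int d) * (if n = 2 then q_par powi int b else 1))) \<cdot>\<^sub>K
      ket (add_at 1 (row2 a (c - 1)), row2 b d)"
proof -
  have n: "0 + 1 = (1::nat)" "0 < (1::nat)" "1 \<le> n" "1 \<noteq> n"
    using n_ge_2 by auto
  have k: "k_eigval n (eps \<kappa>) 0 (row2 b d) = q_par powi (- int d) * (if n = 2 then q_par powi int b else 1)"
    using n_ge_2 k_eigval_row2(4,5)[of b d] by (cases "n = 2") (auto simp: q_powi_diff)
  show ?thesis
    unfolding act_e_ket[OF row2_mem row2_mem] n(1) cyc_small[OF n(2,3)] cyc_0
      shift_row2(2)[OF n(4)] row2_apply k
    using n(3) by (simp add: ket2_in_def)
qed

lemma act_e_step:
  assumes "0 < j" "j < n - 1"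
  shows "act x y (Gen_e j) (ket (row2 a c, add_at j (row2 b d))) = ket (row2 a c, add_at (j + 1) (row2 b d))"
    and "act x y (Gen_e j) (ket (add_at j (row2 a c), row2 b d)) =
      (if j + 1 = n - 1 then q_par powi int b else 1) \<cdot>\<^sub>K ket (add_at (j + 1) (row2 a c), row2 b d)"
proof -
  have n: "j \<le> n" "0 < j + 1" "j + 1 \<le> n" "j \<noteq> j + 1" "j \<in> {1..n}" "j + 1 \<in> {1..n}" "j \<noteq> 0"
    using assms by auto
  have k: "k_eigval n (eps \<kappa>) j (row2 b d) = (if j + 1 = n - 1 then q_par powi int b else 1)"
  proof (cases "j + 1 = n - 1")
    case True
    then have "j = n - 2" "2 < n"
      using assms by auto
    then show ?thesis
      using k_eigval_row2(3)[of b d] True by simp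
  qed (use assms k_eigval_row2(2)[of j b d] in auto)
  show "act x y (Gen_e j) (ket (row2 a c, add_at j (row2 b d))) = ket (row2 a c, add_at (j + 1) (row2 b d))"
    unfolding act_e_ket[OF row2_mem add_at_row2_mem[OF n(5)]] cyc_small[OF assms(1) n(1)] cyc_small[OF n(2,3)]
      shift_add_at[OF n(4)] add_at_apply row2_apply(3)[OF assms(2)]
    using n by (simp add: ket2_in_def)
  show "act x y (Gen_e j) (ket (add_at j (row2 a c), row2 b d)) =
      (if j + 1 = n - 1 then q_par powi int b else 1) \<cdot>\<^sub>K ket (add_at (j + 1) (row2 a c), row2 b d)"
    unfolding act_e_ket[OF add_at_row2_mem[OF n(5)] row2_mem] cyc_small[OF assms(1) n(1)] cyc_small[OF n(2,3)]
      shift_add_at[OF n(4)] add_at_apply row2_apply(3)[OF assms(2)] k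
    using n by (simp add: ket2_in_def)
qed

text \<open>Only the tensor factor holding the travelling particle responds to the later generators, so no branching
  occurs after the first step. The powers of \<open>q\<close> come from the Cartan parts: \<open>k\<^sub>0\<close> sees row \<open>n\<close>,
  \<open>k\<^sub>n\<^sub>-\<^sub>2\<close> sees row \<open>n - 1\<close>, and the generators in between see empty rows. If \<open>n = 2\<close> both effects
  belong to \<open>k\<^sub>0\<close>, which is the reason for the case distinctions.\<close>
lemma E0_row_ket:
  "E0 x y (row_ket a c b d) = (y * qint d) \<cdot>\<^sub>K row_ket a c (b + 1) (d - 1) +
    (x * qint c * q_par powi (int b - int d)) \<cdot>\<^sub>K row_ket (a + 1) (c - 1) b d"
proof -
  have chain: "fold (\<lambda>i. act x y (Gen_e i)) [0..<t] (row_ket a c b d) =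
      (y * qint d) \<cdot>\<^sub>K ket (row2 a c, add_at t (row2 b (d - 1))) +
      (x * qint c * (q_par powi (- int d) * (if t = n - 1 then q_par powi int b else 1))) \<cdot>\<^sub>K
        ket (add_at t (row2 a (c - 1)), row2 b d)"
    if "0 < t" "t \<le> n - 1" for t
    using that
  proof (induction t)
    case (Suc t)
    show ?case
    proof (cases "t = 0")
      case True
      then show ?thesis
        using n_ge_2 by (auto simp: act_e_0)
    next
      case False
      then have t: "0 < t" "t < n - 1" "t \<le> n - 1" "t \<noteq> n - 1"
        using Suc.prems by auto
      have "[0..<Suc t] = [0..<t] @ [t]" by simp
      then show ?thesis
        unfolding \<open>[0..<Suc t] = [0..<t] @ [t]\<close> fold_append comp_apply Suc.IH[OF t(1,3)] fold_simps
          act_add act_smul act_e_step[OF t(1,2)]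
        using t(4) by (simp add: mult.assoc)
    qed
  qed simp
  have n: "0 < n - 1" "n - 1 \<le> n - 1"
    using n_ge_2 by auto
  show ?thesis
    unfolding E0_def chain[OF n] add_at_row2 q_powi_diff by simp
qed

lemma act_f_first:
  "act x y (Gen_f (n - 2)) (row_ket a c b d) =
    ((if n = 2 then inverse x else 1) * qint a) \<cdot>\<^sub>K ket (add_at (cyc n (n - 2)) (row2 (a - 1) c), row2 b d) +
    ((if n = 2 then inverse y * q_par powi int c else 1) * (q_par powi (- int a) * qint b)) \<cdot>\<^sub>K
      ket (row2 a c, add_at (cyc n (n - 2)) (row2 (b - 1) d))"
proof -
  have n: "n - 2 + 1 = n - 1" "0 < n - 1" "n - 1 \<le> n" "n - 2 < n"
    using n_ge_2 by auto
  have ne: "cyc n (n - 2) \<noteq> n - 1"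
    using cyc_Suc_neq[OF n(4)] unfolding n(1) cyc_small[OF n(2,3)] by simp
  have k: "inverse (k_eigval n (eps \<kappa>) (n - 2) (row2 a c)) =
      (if n = 2 then q_par powi int c else 1) * q_par powi (- int a)"
  proof (cases "n = 2")
    case True
    then have "k_eigval n (eps \<kappa>) (n - 2) (row2 a c) = q_par powi (int a - int c)"
      using k_eigval_row2(5)[of a c] by simp
    then have "inverse (k_eigval n (eps \<kappa>) (n - 2) (row2 a c)) = q_par powi (int c - int a)"
      by (simp flip: power_int_minus)
    then show ?thesis
      using True by (simp add: q_powi_diff mult.commute)
  qed (use n_ge_2 k_eigval_row2(3)[of a c] in \<open>simp add: power_int_minus\<close>)
  show ?thesis
    unfolding act_f_ket[OF row2_mem row2_mem] n(1) cyc_small[OF n(2,3)] shift_row2(1)[OF ne] row2_apply k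
    using n_ge_2 cyc_mem by (auto simp add: ket2_in_def)
qed

lemma act_f_step:
  assumes "j + 1 < n - 1"
  shows "act x y (Gen_f j) (ket (add_at (j + 1) (row2 a c), row2 b d)) =
      (if j = 0 then inverse x else 1) \<cdot>\<^sub>K ket (add_at (cyc n j) (row2 a c), row2 b d)"
    and "act x y (Gen_f j) (ket (row2 a c, add_at (j + 1) (row2 b d))) =
      (if j = 0 then inverse y * q_par powi int c else 1) \<cdot>\<^sub>K ket (row2 a c, add_at (cyc n j) (row2 b d))"
proof -
  have n: "0 < j + 1" "j + 1 \<le> n" "j < n" "j + 1 \<in> {1..n}"
    using assms by auto
  have ne: "j + 1 \<noteq> cyc n j"
    using cyc_Suc_neq[OF n(3)] unfolding cyc_small[OF n(1,2)] .
  have k: "inverse (k_eigval n (eps \<kappa>) j (row2 a c)) = (if j = 0 then q_par powi int c else 1)"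
    using assms k_eigval_row2(2)[of j a c] k_eigval_row2(4)[of a c] by (auto simp: power_int_minus)
  show "act x y (Gen_f j) (ket (add_at (j + 1) (row2 a c), row2 b d)) =
      (if j = 0 then inverse x else 1) \<cdot>\<^sub>K ket (add_at (cyc n j) (row2 a c), row2 b d)"
    unfolding act_f_ket[OF add_at_row2_mem[OF n(4)] row2_mem] cyc_small[OF n(1,2)]
      shift_add_at[OF ne] add_at_apply row2_apply(3)[OF assms]
    using cyc_mem by (simp add: ket2_in_def)
  show "act x y (Gen_f j) (ket (row2 a c, add_at (j + 1) (row2 b d))) =
      (if j = 0 then inverse y * q_par powi int c else 1) \<cdot>\<^sub>K ket (row2 a c, add_at (cyc n j) (row2 b d))"
    unfolding act_f_ket[OF row2_mem add_at_row2_mem[OF n(4)]] cyc_small[OF n(1,2)]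
      shift_add_at[OF ne] add_at_apply row2_apply(3)[OF assms] k
    using cyc_mem by (simp add: ket2_in_def)
qed

lemma F0_row_ket:
  "F0 x y (row_ket a c b d) = (inverse x * qint a) \<cdot>\<^sub>K row_ket (a - 1) (c + 1) b d +
    (inverse y * q_par powi (int c - int a) * qint b) \<cdot>\<^sub>K row_ket a c (b - 1) (d + 1)"
proof -
  have chain: "foldr (\<lambda>i. act x y (Gen_f i)) [t..<n - 1] (row_ket a c b d) =
      ((if t = 0 then inverse x else 1) * qint a) \<cdot>\<^sub>K ket (add_at (cyc n t) (row2 (a - 1) c), row2 b d) +
      ((if t = 0 then inverse y * q_par powi int c else 1) * (q_par powi (- int a) * qint b)) \<cdot>\<^sub>K
        ket (row2 a c, add_at (cyc n t) (row2 (b - 1) d))"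
    if "t \<le> n - 2" for t
    using that
  proof (induction t rule: inc_induct)
    case base
    have "n - 1 = Suc (n - 2)"
      using n_ge_2 by simp
    then have "[n - 2..<n - 1] = [n - 2]"
      by simp
    moreover have "n - 2 = 0 \<longleftrightarrow> n = 2"
      using n_ge_2 by auto
    ultimately show ?case
      by (simp only: act_f_first foldr.simps comp_apply id_apply simp_thms)
  next
    case (step t)
    have t: "t + 1 < n - 1" "Suc t \<le> n" "[t..<n - 1] = t # [Suc t..<n - 1]"
      using step.hyps by (auto simp: upt_rec)
    have "cyc n (Suc t) = t + 1"
      using t by (simp add: cyc_small)
    then show ?case
      unfolding t(3) foldr.simps comp_apply step.IH act_add act_smul \<open>cyc n (Suc t) = t + 1\<close> act_f_step[OF t(1)]
      by (simp add: mult_ac)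
  qed
  show ?thesis
    unfolding F0_def chain[OF le0] cyc_0 add_at_row2 q_powi_diff by (simp add: mult_ac)
qed

end

section \<open>Singular vectors\<close>

definition xi_coeff :: "nat \<Rightarrow> nat \<Rightarrow> nat \<Rightarrow> scal" where
  "xi_coeff m s j =
    (- 1) ^ j * q_par powi (int j * (2 * int s - int m - int j - 1) + int m * int s) * qbinom s j"

lemma qbinom_Suc_right: "j < s \<Longrightarrow> qbinom s (Suc j) * qint (Suc j) = qint (s - j) * qbinom s j"
proof -
  assume "j < s"
  then obtain k where s: "s = Suc (j + k)"
    using less_imp_Suc_add by blast
  have "s - j = Suc k" "s - Suc j = k"
    using s by auto
  then show ?thesis
    by (simp add: qbinom_def qfact_Suc field_simps)
qed

lemma qbinom_Suc_left: "j \<le> s \<Longrightarrow> qbinom (Suc s) j * qint (Suc s - j) = qint (Suc s) * qbinom s j"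
  by (simp add: qbinom_def qfact_Suc Suc_diff_le field_simps)

lemma pos_scal_qbinom: "qbinom s j \<in> pos_scal"
  unfolding qbinom_def by (intro pos_scal_divide pos_scal_mult pos_scal_qfact)

lemma xi_coeff_sign: "\<exists>p\<in>pos_scal. xi_coeff m s j = (- 1) ^ j * p"
  by (rule bexI[of _ "q_par powi (int j * (2 * int s - int m - int j - 1) + int m * int s) * qbinom s j"])
     (auto simp: xi_coeff_def mult.assoc intro: pos_scal_mult pos_scal_qbinom)

lemma xi_coeff_0_nonzero: "xi_coeff m s 0 \<noteq> 0"
  by (simp add: xi_coeff_def pos_scal_nonzero[OF pos_scal_qbinom])

lemma xi_coeff_Suc:
  assumes "j < s"
  shows "xi_coeff m s (Suc j) * qint (Suc j) =
    - (q_par powi (2 * int s - int m - 2 * int j - 2) * qint (s - j) * xi_coeff m s j)"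
proof -
  have "int (Suc j) * (2 * int s - int m - int (Suc j) - 1) + int m * int s =
    (2 * int s - int m - 2 * int j - 2) + (int j * (2 * int s - int m - int j - 1) + int m * int s)"
    by (simp add: algebra_simps)
  then have "q_par powi (int (Suc j) * (2 * int s - int m - int (Suc j) - 1) + int m * int s) =
    q_par powi (2 * int s - int m - 2 * int j - 2) * q_par powi (int j * (2 * int s - int m - int j - 1) + int m * int s)"
    by (simp only: power_int_add q_par_nonzero simp_thms)
  then show ?thesis
    unfolding xi_coeff_def using qbinom_Suc_right[OF assms] by (simp add: mult_ac)
qed

lemma xi_coeff_pred:
  assumes "j \<le> s"
  shows "xi_coeff m (Suc s) j * qint (Suc s - j) =
    q_par powi (2 * int j + int m) * qint (Suc s) * xi_coeff m s j"
proof -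
  have "int j * (2 * int (Suc s) - int m - int j - 1) + int m * int (Suc s) =
    (2 * int j + int m) + (int j * (2 * int s - int m - int j - 1) + int m * int s)"
    by (simp add: algebra_simps)
  then have "q_par powi (int j * (2 * int (Suc s) - int m - int j - 1) + int m * int (Suc s)) =
    q_par powi (2 * int j + int m) * q_par powi (int j * (2 * int s - int m - int j - 1) + int m * int s)"
    by (simp only: power_int_add q_par_nonzero simp_thms)
  then show ?thesis
    unfolding xi_coeff_def using qbinom_Suc_left[OF assms] by (simp add: mult_ac)
qed

context rows
begin

text \<open>The vectors on the last two rows with \<open>N\<close> particles in row \<open>n - 1\<close>, for \<open>N \<le> min l m\<close>, so that
  none of the truncated subtractions is effective.\<close>
definition level :: "nat \<Rightarrow> nat \<Rightarrow> nat \<Rightarrow> (nat \<Rightarrow> scal) \<Rightarrow> (midx \<times> midx \<Rightarrow>\<^sub>0 scal)" where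
  "level l m N c = (\<Sum>j\<le>N. c j \<cdot>\<^sub>K row_ket j (l - j) (N - j) (m - (N - j)))"

lemma row2_eq_iff: "row2 a c = row2 a' c' \<longleftrightarrow> a = a' \<and> c = c'"
  using row2_apply(1,2) by metis

lemma lookup_level:
  assumes "j \<le> N"
  shows "Poly_Mapping.lookup (level l m N c) (row2 j (l - j), row2 (N - j) (m - (N - j))) = c j"
proof -
  have "Poly_Mapping.lookup (level l m N c) (row2 j (l - j), row2 (N - j) (m - (N - j))) =
    (\<Sum>i\<le>N. if i = j then c i else 0)"
    unfolding level_def lookup_sum
    by (intro sum.cong) (auto simp: lookup_ket row2_eq_iff)
  then show ?thesis
    using assms by simp
qed

lemma level_eq_iff: "level l m N c = level l m N d \<longleftrightarrow> (\<forall>j\<le>N. c j = d j)"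
proof
  assume eq: "level l m N c = level l m N d"
  show "\<forall>j\<le>N. c j = d j"
    using lookup_level[of _ N l m c] lookup_level[of _ N l m d] unfolding eq by metis
qed (auto simp: level_def)

lemma smul_level: "a \<cdot>\<^sub>K level l m N c = level l m N (\<lambda>j. a * c j)"
  by (simp add: level_def smul.scale_sum_right)

lemma level_add: "level l m N c + level l m N d = level l m N (\<lambda>j. c j + d j)"
  by (simp add: level_def smul.scale_left_distrib sum.distrib)

lemma xi_eq_level:
  assumes "s \<le> m"
  shows "xi n l m s = level l m s (xi_coeff m s)"
  unfolding xi_def level_def xi_coeff_def
proof (rule sum.cong)
  fix j assume "j \<in> {..s}"
  then have "m - s + j = m - (s - j)"
    using assms by auto
  then show "((- 1) ^ j * q_par powi (int j * (2 * int s - int m - int j - 1) + int m * int s) * qbinom s j) \<cdot>\<^sub>K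
      tens (ket (row2 j (l - j))) (ket (row2 (s - j) (m - s + j))) =
    ((- 1) ^ j * q_par powi (int j * (2 * int s - int m - int j - 1) + int m * int s) * qbinom s j) \<cdot>\<^sub>K
      row_ket j (l - j) (s - j) (m - (s - j))"
    by simp
qed auto

text \<open>Common form of the actions of \<open>e\<^sub>n\<^sub>-\<^sub>1\<close> and of the chain \<open>F0\<close>, both of which take one particle out of
  row \<open>n - 1\<close>.\<close>
lemma lowering_level:
  assumes op: "linear_map op"
    and op_row_ket: "\<And>a c b d. op (row_ket a c b d) =
      (\<alpha> a c b d * qint b) \<cdot>\<^sub>K row_ket a c (b - 1) (d + 1) + (\<beta> a c b d * qint a) \<cdot>\<^sub>K row_ket (a - 1) (c + 1) b d"
    and "Suc N \<le> l" "Suc N \<le> m"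
  shows "op (level l m (Suc N) c) = level l m N (\<lambda>j.
    \<alpha> j (l - j) (Suc N - j) (m - (Suc N - j)) * qint (Suc N - j) * c j +
    \<beta> (Suc j) (l - Suc j) (N - j) (m - (N - j)) * qint (Suc j) * c (Suc j))"
proof -
  let ?\<alpha> = "\<lambda>j. \<alpha> j (l - j) (Suc N - j) (m - (Suc N - j)) * qint (Suc N - j) * c j"
  let ?\<beta> = "\<lambda>j. \<beta> j (l - j) (Suc N - j) (m - (Suc N - j)) * qint j * c j"
  have "op (level l m (Suc N) c) =
    (\<Sum>j\<le>Suc N. ?\<alpha> j \<cdot>\<^sub>K row_ket j (l - j) (Suc N - j - 1) (m - (Suc N - j) + 1)) +
    (\<Sum>j\<le>Suc N. ?\<beta> j \<cdot>\<^sub>K row_ket (j - 1) (l - j + 1) (Suc N - j) (m - (Suc N - j)))"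
    unfolding level_def smul_pair.linear_sum[OF op] smul_pair.linear_scale[OF op] op_row_ket
    by (simp only: smul.scale_right_distrib sum.distrib smul.scale_scale mult_ac)
  also have "(\<Sum>j\<le>Suc N. ?\<alpha> j \<cdot>\<^sub>K row_ket j (l - j) (Suc N - j - 1) (m - (Suc N - j) + 1)) =
    (\<Sum>j\<le>N. ?\<alpha> j \<cdot>\<^sub>K row_ket j (l - j) (N - j) (m - (N - j)))"
  proof -
    have "row_ket j (l - j) (Suc N - j - 1) (m - (Suc N - j) + 1) = row_ket j (l - j) (N - j) (m - (N - j))" if "j \<le> N" for j
    proof -
      have "Suc N - j - 1 = N - j" "m - (Suc N - j) + 1 = m - (N - j)"
        using that assms by auto
      then show ?thesis by (simp only:)
    qed
    then show ?thesis
      by (simp add: sum.atMost_Suc)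
  qed
  also have "(\<Sum>j\<le>Suc N. ?\<beta> j \<cdot>\<^sub>K row_ket (j - 1) (l - j + 1) (Suc N - j) (m - (Suc N - j))) =
    (\<Sum>j\<le>N. ?\<beta> (Suc j) \<cdot>\<^sub>K row_ket j (l - j) (N - j) (m - (N - j)))"
  proof -
    have "row_ket (Suc j - 1) (l - Suc j + 1) (Suc N - Suc j) (m - (Suc N - Suc j)) =
      row_ket j (l - j) (N - j) (m - (N - j))" if "j \<le> N" for j
    proof -
      have "Suc j - 1 = j" "l - Suc j + 1 = l - j" "Suc N - Suc j = N - j"
        using that assms by auto
      then show ?thesis by (simp only:)
    qed
    then show ?thesis
      unfolding sum.atMost_Suc_shift by simp
  qed
  finally show ?thesis
    by (simp add: level_def smul.scale_left_distrib sum.distrib)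
qed

lemma linear_map_fold:
  assumes "\<And>i. linear_map (f i)"
  shows "linear_map (fold f is)"
proof (induction "is")
  case Nil
  show ?case
    using smul.linear_id by (simp add: id_def)
next
  case (Cons i "is")
  then show ?case
    using Vector_Spaces.linear_compose[OF assms[of i]] by (simp add: comp_def)
qed

lemma linear_map_E0: "linear_map (E0 x y)"
  unfolding E0_def[abs_def] by (rule linear_map_fold) (rule linear_map_act)

lemma linear_map_F0: "linear_map (F0 x y)"
  unfolding F0_def[abs_def] foldr_conv_fold by (rule linear_map_fold) (rule linear_map_act)

lemma e_level:
  assumes "Suc N \<le> l" "Suc N \<le> m"
  shows "act x y (Gen_e (n - 1)) (level l m (Suc N) c) = level l m N (\<lambda>j.
    qint (Suc N - j) * c j + q_par powi (int m - 2 * int N + 2 * int j) * qint (Suc j) * c (Suc j))"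
proof -
  have 1: "act x y (Gen_e (n - 1)) (level l m (Suc N) c) = level l m N (\<lambda>j.
    1 * qint (Suc N - j) * c j +
    q_par powi (int (m - (N - j)) - int (N - j)) * qint (Suc j) * c (Suc j))"
    by (rule lowering_level[OF linear_map_act _ assms, where \<alpha> = "\<lambda>_ _ _ _. 1" and
          \<beta> = "\<lambda>a c b d. q_par powi (int d - int b)"])
       (simp add: act_e_last[unfolded One_nat_def] mult.commute)
  have 2: "int (m - (N - j)) - int (N - j) = int m - 2 * int N + 2 * int j" if "j \<le> N" for j
    using that assms by (simp add: of_nat_diff)
  show ?thesis
    unfolding 1 level_eq_iff by (intro allI impI) (simp only: 2 mult_1_left)
qed

lemma F0_level:
  assumes "Suc N \<le> l" "Suc N \<le> m"
  shows "F0 x y (level l m (Suc N) c) = level l m N (\<lambda>j.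
    inverse y * q_par powi (int l - 2 * int j) * qint (Suc N - j) * c j + inverse x * qint (Suc j) * c (Suc j))"
proof -
  have 1: "F0 x y (level l m (Suc N) c) = level l m N (\<lambda>j.
    (inverse y * q_par powi (int (l - j) - int j)) * qint (Suc N - j) * c j +
    inverse x * qint (Suc j) * c (Suc j))"
    by (rule lowering_level[OF linear_map_F0 _ assms, where \<beta> = "\<lambda>_ _ _ _. inverse x" and
          \<alpha> = "\<lambda>a c b d. inverse y * q_par powi (int c - int a)"])
       (simp add: F0_row_ket[unfolded One_nat_def] mult.commute add.commute)
  have 2: "int (l - j) - int j = int l - 2 * int j" if "j \<le> N" for j
    using that assms by (simp add: of_nat_diff)
  show ?thesis
    unfolding 1 level_eq_iff by (intro allI impI) (simp only: 2 mult_1_left)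
qed

lemma e_xi:
  assumes "Suc N \<le> l" "Suc N \<le> m"
  shows "act x y (Gen_e (n - 1)) (xi n l m (Suc N)) = 0"
proof -
  have "qint (Suc N - j) * xi_coeff m (Suc N) j +
      q_par powi (int m - 2 * int N + 2 * int j) * qint (Suc j) * xi_coeff m (Suc N) (Suc j) = 0"
    if "j \<le> N" for j
  proof -
    have "q_par powi (int m - 2 * int N + 2 * int j) * q_par powi (2 * int (Suc N) - int m - 2 * int j - 2) = 1"
      by (simp flip: power_int_add)
    then show ?thesis
      using xi_coeff_Suc[of j "Suc N" m] that by (simp add: mult.assoc mult.commute[of "qint (Suc j)"] mult.left_commute) 
  qed
  then have "act x y (Gen_e (n - 1)) (xi n l m (Suc N)) = level l m N (\<lambda>_. 0)"
    unfolding xi_eq_level[OF assms(2)] e_level[OF assms] level_eq_iff by blast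
  then show ?thesis
    by (simp add: level_def)
qed

text \<open>The condition of being annihilated by \<open>e\<^sub>n\<^sub>-\<^sub>1\<close> is a two-term recursion for the coefficients, and the
  coefficients of \<open>xi\<close> solve it; a solution is determined by its value at \<open>0\<close>.\<close>
lemma singular_unique:
  assumes "Suc N \<le> l" "Suc N \<le> m"
    and "act x y (Gen_e (n - 1)) (level l m (Suc N) c) = 0"
  shows "\<exists>a. level l m (Suc N) c = a \<cdot>\<^sub>K xi n l m (Suc N)"
proof -
  let ?w = "xi_coeff m (Suc N)"
  have "level l m N (\<lambda>j. qint (Suc N - j) * c j +
      q_par powi (int m - 2 * int N + 2 * int j) * qint (Suc j) * c (Suc j)) = level l m N (\<lambda>_. 0)"
    using assms(3) unfolding e_level[OF assms(1,2)] by (simp add: level_def)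
  then have c: "qint (Suc N - j) * c j +
      q_par powi (int m - 2 * int N + 2 * int j) * qint (Suc j) * c (Suc j) = 0" if "j \<le> N" for j
    using that unfolding level_eq_iff by blast
  have "c j * ?w 0 = c 0 * ?w j" if "j \<le> Suc N" for j
    using that
  proof (induction j)
    case (Suc j)
    define A where "A = q_par powi (int m - 2 * int N + 2 * int j)"
    have A: "A \<noteq> 0" "A * q_par powi (2 * int (Suc N) - int m - 2 * int j - 2) = 1"
      by (simp_all add: A_def flip: power_int_add)
    have "A * (?w (Suc j) * qint (Suc j)) = - (qint (Suc N - j) * ?w j)"
      using xi_coeff_Suc[of j "Suc N" m] Suc.prems A(2) by (simp add: mult.assoc mult.left_commute)
    moreover have "A * (c (Suc j) * qint (Suc j)) = - (qint (Suc N - j) * c j)"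
      using c[of j] Suc.prems by (simp add: A_def eq_neg_iff_add_eq_0 mult_ac add.commute)
    ultimately have "A * (c (Suc j) * qint (Suc j)) * ?w 0 = A * (?w (Suc j) * qint (Suc j)) * c 0"
      using Suc by (simp add: mult_ac)
    then have "(A * qint (Suc j)) * (c (Suc j) * ?w 0) = (A * qint (Suc j)) * (c 0 * ?w (Suc j))"
      by (simp only: mult_ac)
    moreover have "A * qint (Suc j) \<noteq> 0"
      using A by simp
    ultimately show ?case
      using mult_left_cancel by blast
  qed simp
  then have "level l m (Suc N) c = level l m (Suc N) (\<lambda>j. (c 0 / ?w 0) * ?w j)"
    unfolding level_eq_iff using xi_coeff_0_nonzero by (simp add: field_simps)
  then show ?thesis
    unfolding xi_eq_level[OF assms(2)] smul_level by blast
qed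

text \<open>The generators \<open>f\<^sub>0, \<dots>, f\<^sub>n\<^sub>-\<^sub>2\<close> commute with \<open>e\<^sub>n\<^sub>-\<^sub>1\<close>, so \<open>F0\<close> must send one singular vector to a multiple
  of the preceding one. The multiple, read off from the coefficients, is the source of the eigenvalues.\<close>
lemma F0_xi:
  assumes "Suc N \<le> l" "Suc N \<le> m"
  shows "F0 x y (xi n l m (Suc N)) =
    (qint (Suc N) * (inverse y * q_par powi (int l + int m) - inverse x * q_par powi (2 * int N))) \<cdot>\<^sub>K xi n l m N"
proof -
  have "inverse y * q_par powi (int l - 2 * int j) * qint (Suc N - j) * xi_coeff m (Suc N) j +
      inverse x * qint (Suc j) * xi_coeff m (Suc N) (Suc j) =
    qint (Suc N) * (inverse y * q_par powi (int l + int m) - inverse x * q_par powi (2 * int N)) * xi_coeff m N j"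
    if "j \<le> N" for j
  proof -
    have 1: "q_par powi (int l - 2 * int j) * q_par powi (2 * int j + int m) = q_par powi (int l + int m)"
      "q_par powi (2 * int (Suc N) - int m - 2 * int j - 2) * q_par powi (2 * int j + int m) = q_par powi (2 * int N)"
      by (simp_all flip: power_int_add)
    have "inverse y * q_par powi (int l - 2 * int j) * qint (Suc N - j) * xi_coeff m (Suc N) j +
        inverse x * qint (Suc j) * xi_coeff m (Suc N) (Suc j) =
      inverse y * q_par powi (int l - 2 * int j) * (xi_coeff m (Suc N) j * qint (Suc N - j)) +
        inverse x * (xi_coeff m (Suc N) (Suc j) * qint (Suc j))"
      by (simp only: mult_ac)
    also have "\<dots> = (inverse y * q_par powi (int l - 2 * int j) -
        inverse x * q_par powi (2 * int (Suc N) - int m - 2 * int j - 2)) * (xi_coeff m (Suc N) j * qint (Suc N - j))"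
      using xi_coeff_Suc[of j "Suc N" m] that by (simp only: less_Suc_eq_le) (simp add: algebra_simps)
    also have "\<dots> = (inverse y * q_par powi (int l - 2 * int j) -
        inverse x * q_par powi (2 * int (Suc N) - int m - 2 * int j - 2)) * q_par powi (2 * int j + int m) *
        (qint (Suc N) * xi_coeff m N j)"
      unfolding xi_coeff_pred[OF that] by (simp only: mult.assoc)
    also have "\<dots> = (inverse y * q_par powi (int l + int m) - inverse x * q_par powi (2 * int N)) *
        (qint (Suc N) * xi_coeff m N j)"
      unfolding left_diff_distrib mult.assoc 1(1) using 1(2) by (simp only: mult.assoc[symmetric])
    finally show ?thesis
      by (simp only: mult_ac)
  qed
  then show ?thesis
    using assms by (simp only: xi_eq_level Suc_leD F0_level smul_level level_eq_iff) auto
qed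

lemma xi_nonzero: "s \<le> m \<Longrightarrow> xi n l m s \<noteq> 0"
  using lookup_level[of 0 s l m "xi_coeff m s"] xi_coeff_0_nonzero[of m s] by (auto simp: xi_eq_level)

lemma row_ket_mem_WW: "a \<le> l \<Longrightarrow> b \<le> m \<Longrightarrow> row_ket a (l - a) b (m - b) \<in> WW n (eps \<kappa>) l m"
  by (simp add: ket_in_WW_iff row2_mem_deg)

lemma level_mem_WW: "N \<le> l \<Longrightarrow> N \<le> m \<Longrightarrow> level l m N c \<in> WW n (eps \<kappa>) l m"
  unfolding level_def
  by (intro smul.subspace_sum smul.subspace_scale subspace_WW row_ket_mem_WW) auto

end

section \<open>Eigenvalues\<close>

text \<open>Cramer's rule modulo a subspace.\<close>
lemma subspace_solve2:
  assumes S: "smul.subspace S" and det: "a * d - b * c \<noteq> 0"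
    and u: "a \<cdot>\<^sub>K v + b \<cdot>\<^sub>K w \<in> S" and u': "c \<cdot>\<^sub>K v + d \<cdot>\<^sub>K w \<in> S"
  shows "v \<in> S" "w \<in> S"
proof -
  let ?u = "a \<cdot>\<^sub>K v + b \<cdot>\<^sub>K w" and ?u' = "c \<cdot>\<^sub>K v + d \<cdot>\<^sub>K w"
  have "d \<cdot>\<^sub>K ?u - b \<cdot>\<^sub>K ?u' = (a * d - b * c) \<cdot>\<^sub>K v"
    by (simp add: algebra_simps smul.scale_right_distrib smul.scale_left_diff_distrib)
  then have "(a * d - b * c) \<cdot>\<^sub>K v \<in> S"
    using smul.subspace_diff[OF S smul.subspace_scale[OF S u] smul.subspace_scale[OF S u']] by metis
  then have "inverse (a * d - b * c) \<cdot>\<^sub>K (a * d - b * c) \<cdot>\<^sub>K v \<in> S"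
    by (rule smul.subspace_scale[OF S])
  then show "v \<in> S"
    using det by simp
  have "a \<cdot>\<^sub>K ?u' - c \<cdot>\<^sub>K ?u = (a * d - b * c) \<cdot>\<^sub>K w"
    by (simp add: algebra_simps smul.scale_right_distrib smul.scale_left_diff_distrib)
  then have "(a * d - b * c) \<cdot>\<^sub>K w \<in> S"
    using smul.subspace_diff[OF S smul.subspace_scale[OF S u'] smul.subspace_scale[OF S u]] by metis
  then have "inverse (a * d - b * c) \<cdot>\<^sub>K (a * d - b * c) \<cdot>\<^sub>K w \<in> S"
    by (rule smul.subspace_scale[OF S])
  then show "w \<in> S"
    using det by simp
qed

lemma subspace_smul_iff:
  assumes "smul.subspace S" "c \<noteq> 0"
  shows "c \<cdot>\<^sub>K v \<in> S \<longleftrightarrow> v \<in> S"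
proof
  assume "c \<cdot>\<^sub>K v \<in> S"
  then have "inverse c \<cdot>\<^sub>K c \<cdot>\<^sub>K v \<in> S"
    by (rule smul.subspace_scale[OF assms(1)])
  then show "v \<in> S"
    using assms(2) by simp
qed (rule smul.subspace_scale[OF assms(1)])

lemma lin_hom_subspace_preimage:
  assumes T: "T \<in> lin_hom A B" and A: "smul.subspace A" and S: "smul.subspace S"
  shows "smul.subspace {v \<in> A. T v \<in> S}"
proof (rule smul.subspaceI)
  have "T (0 \<cdot>\<^sub>K 0) = 0 \<cdot>\<^sub>K T 0"
    using T smul.subspace_0[OF A] unfolding lin_hom_def by blast
  then show "0 \<in> {v \<in> A. T v \<in> S}"
    using smul.subspace_0[OF A] smul.subspace_0[OF S] by simp
next
  fix u v assume "u \<in> {v \<in> A. T v \<in> S}" "v \<in> {v \<in> A. T v \<in> S}"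
  moreover from this have "T (u + v) = T u + T v"
    using T unfolding lin_hom_def by blast
  ultimately show "u + v \<in> {v \<in> A. T v \<in> S}"
    using smul.subspace_add[OF A] smul.subspace_add[OF S] by simp
next
  fix c v assume "v \<in> {v \<in> A. T v \<in> S}"
  moreover from this have "T (c \<cdot>\<^sub>K v) = c \<cdot>\<^sub>K T v"
    using T unfolding lin_hom_def by blast
  ultimately show "c \<cdot>\<^sub>K v \<in> {v \<in> A. T v \<in> S}"
    using smul.subspace_scale[OF A] smul.subspace_scale[OF S] by simp
qed

context rows
begin

definition intertwiner :: "nat \<Rightarrow> nat \<Rightarrow> ((midx \<times> midx \<Rightarrow>\<^sub>0 scal) \<Rightarrow> (midx \<times> midx \<Rightarrow>\<^sub>0 scal)) \<Rightarrow> bool" where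
  "intertwiner l m T \<longleftrightarrow> T \<in> lin_hom (WW n (eps \<kappa>) l m) (WW n (eps \<kappa>) m l) \<and>
     (\<forall>g v. gen_index g < n \<longrightarrow> v \<in> WW n (eps \<kappa>) l m \<longrightarrow>
        T (act x_par y_par g v) = act y_par x_par g (T v))"

lemma intertwiner_lin_hom: "intertwiner l m T \<Longrightarrow> T \<in> lin_hom (WW n (eps \<kappa>) l m) (WW n (eps \<kappa>) m l)"
  by (simp add: intertwiner_def)

lemma intertwiner_act:
  "intertwiner l m T \<Longrightarrow> gen_index g < n \<Longrightarrow> v \<in> WW n (eps \<kappa>) l m \<Longrightarrow>
    T (act x_par y_par g v) = act y_par x_par g (T v)"
  by (simp add: intertwiner_def)

lemma intertwiner_fold:
  assumes "intertwiner l m T" "v \<in> WW n (eps \<kappa>) l m"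
    and "\<And>i. i \<in> set is \<Longrightarrow> i < n" "G = Gen_e \<or> G = Gen_f"
  shows "T (fold (\<lambda>i. act x_par y_par (G i)) is v) = fold (\<lambda>i. act y_par x_par (G i)) is (T v)"
  using assms(2,3)
proof (induction "is" arbitrary: v)
  case (Cons i "is")
  have g: "gen_index (G i) < n" "\<exists>i'. G i = Gen_e i' \<or> G i = Gen_f i'"
    using assms(4) Cons.prems(2) by auto
  have "T (act x_par y_par (G i) v) = act y_par x_par (G i) (T v)"
    by (rule intertwiner_act[OF assms(1) g(1) Cons.prems(1)])
  then show ?case
    using Cons.IH[OF act_mem_WW[OF g(1) Cons.prems(1) g(2)]] Cons.prems(2) by simp
qed simp

lemma intertwiner_E0:
  assumes "intertwiner l m T" "v \<in> WW n (eps \<kappa>) l m"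
  shows "T (E0 x_par y_par v) = E0 y_par x_par (T v)"
  unfolding E0_def by (rule intertwiner_fold[OF assms]) auto

lemma intertwiner_F0:
  assumes "intertwiner l m T" "v \<in> WW n (eps \<kappa>) l m"
  shows "T (F0 x_par y_par v) = F0 y_par x_par (T v)"
  unfolding F0_def foldr_conv_fold by (rule intertwiner_fold[OF assms]) auto

definition level_space :: "nat \<Rightarrow> nat \<Rightarrow> nat \<Rightarrow> (midx \<times> midx \<Rightarrow>\<^sub>0 scal) set" where
  "level_space l m N = range (level l m N)"

lemma subspace_level_space: "smul.subspace (level_space l m N)"
proof (rule smul.subspaceI)
  have "level l m N (\<lambda>_. 0) = 0"
    by (simp add: level_def)
  then show "0 \<in> level_space l m N"
    unfolding level_space_def by (metis rangeI)
qed (auto simp: level_space_def level_add smul_level)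

lemma row_ket_mem_level_space:
  assumes "a + b = N"
  shows "row_ket a (l - a) b (m - b) \<in> level_space l m N"
proof -
  have "level l m N (\<lambda>j. if j = a then 1 else 0) = row_ket a (l - a) (N - a) (m - (N - a))"
    using assms by (simp add: level_def if_distrib[of "\<lambda>c. c \<cdot>\<^sub>K _"] cong: if_cong)
  moreover have "N - a = b"
    using assms by simp
  ultimately show ?thesis
    unfolding level_space_def by (auto intro: range_eqI[OF sym])
qed

lemma raising_level_space:
  assumes op: "linear_map op"
    and op_row_ket: "\<And>a c b d. \<exists>\<alpha> \<beta>. op (row_ket a c b d) = \<alpha> \<cdot>\<^sub>K row_ket a c (b + 1) (d - 1) + \<beta> \<cdot>\<^sub>K row_ket (a + 1) (c - 1) b d"
    and v: "v \<in> level_space l m N"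
  shows "op v \<in> level_space l m (Suc N)"
proof -
  have "op (row_ket j (l - j) (N - j) (m - (N - j))) \<in> level_space l m (Suc N)" if "j \<le> N" for j
  proof -
    obtain \<alpha> \<beta> where *: "op (row_ket j (l - j) (N - j) (m - (N - j))) =
        \<alpha> \<cdot>\<^sub>K row_ket j (l - j) (N - j + 1) (m - (N - j) - 1) + \<beta> \<cdot>\<^sub>K row_ket (j + 1) (l - j - 1) (N - j) (m - (N - j))"
      using op_row_ket by blast
    show ?thesis
      unfolding * diff_diff_left
      using that by (intro smul.subspace_add smul.subspace_scale subspace_level_space row_ket_mem_level_space) auto
  qed
  moreover obtain c where "v = level l m N c"
    using v by (auto simp: level_space_def)
  ultimately show ?thesis
    by (auto simp: level_def smul_pair.linear_sum[OF op] smul_pair.linear_scale[OF op]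
        intro!: smul.subspace_sum smul.subspace_scale subspace_level_space)
qed

text \<open>The weights alone do not force the image of a two-row vector to be a two-row vector: for
  \<open>n = 4\<close>, \<open>\<kappa> = 2\<close>, moving two units from each of the last two rows to each of the first two leaves all
  eigenvalues of the \<open>k\<^sub>i\<close> unchanged. Instead all two-row vectors with at most \<open>min l m\<close> particles in
  row \<open>n - 1\<close> are produced from the vacuum by \<open>f\<^sub>n\<^sub>-\<^sub>1\<close> and \<open>E0\<close>. Both send a basis vector into the
  span of the same two vectors, with determinant proportional to \<open>y - x q\<^sup>k\<close>, which is nonzero
  because \<open>x\<close> and \<open>y\<close> are independent.\<close>
lemma intertwiner_level:
  assumes T: "intertwiner l m T" and T0: "T (row_ket 0 l 0 m) = row_ket 0 m 0 l"
    and "N \<le> l" "N \<le> m" "a + b = N"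
  shows "T (row_ket a (l - a) b (m - b)) \<in> level_space m l N"
  using assms(3-)
proof (induction N arbitrary: a b)
  case 0
  then have ab: "a = 0" "b = 0"
    by auto
  have "row_ket 0 (m - 0) 0 (l - 0) \<in> level_space m l 0"
    by (rule row_ket_mem_level_space) simp
  then show ?case
    unfolding ab diff_zero T0 .
next
  case (Suc N)
  let ?W = "WW n (eps \<kappa>) l m" and ?f = "Gen_f (n - 1)"
  let ?H = "{v \<in> ?W. T v \<in> level_space m l (Suc N)}"
  have H: "smul.subspace ?H"
    by (rule lin_hom_subspace_preimage[OF intertwiner_lin_hom[OF T] subspace_WW subspace_level_space])
  have *: "row_ket (a + 1) (l - a - 1) b (m - b) \<in> ?H \<and> row_ket a (l - a) (b + 1) (m - b - 1) \<in> ?H"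
    if ab: "a + b = N" for a b
  proof -
    let ?v = "row_ket a (l - a) b (m - b)"
    have less: "a < l" "b < m"
      using ab Suc.prems by auto
    have v: "?v \<in> ?W"
      using less by (intro row_ket_mem_WW) auto
    have Tv: "T ?v \<in> level_space m l N"
      using Suc.prems ab by (intro Suc.IH) auto
    have n: "gen_index ?f < n" "\<exists>i. ?f = Gen_e i \<or> ?f = Gen_f i"
      using n_ge_2 by auto
    note f = act_mem_WW[OF n(1) v n(2)] intertwiner_act[OF T n(1) v]
    have "\<exists>\<alpha> \<beta>. act x y ?f (row_ket a c b d) = \<alpha> \<cdot>\<^sub>K row_ket a c (b + 1) (d - 1) + \<beta> \<cdot>\<^sub>K row_ket (a + 1) (c - 1) b d"
      for x y a c b d
      unfolding act_f_last by (intro exI) (rule add.commute)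
    from raising_level_space[OF linear_map_act this Tv, of y_par x_par]
    have "T (act x_par y_par ?f ?v) \<in> level_space m l (Suc N)"
      unfolding f(2) .
    then have 1: "act x_par y_par ?f ?v \<in> ?H"
      using f(1) by blast
    have "E0 x_par y_par ?v \<in> ?W"
      unfolding E0_row_ket diff_diff_left using less
      by (intro smul.subspace_add smul.subspace_scale subspace_WW row_ket_mem_WW) auto
    moreover have "\<exists>\<alpha> \<beta>. E0 x y (row_ket a c b d) = \<alpha> \<cdot>\<^sub>K row_ket a c (b + 1) (d - 1) + \<beta> \<cdot>\<^sub>K row_ket (a + 1) (c - 1) b d"
      for x y a c b d
      unfolding E0_row_ket by (intro exI) (rule refl)
    from raising_level_space[OF linear_map_E0 this Tv, of y_par x_par]
    have "T (E0 x_par y_par ?v) \<in> level_space m l (Suc N)"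
      unfolding intertwiner_E0[OF T v] .
    ultimately have 2: "E0 x_par y_par ?v \<in> ?H"
      by blast
    \<comment> \<open>The determinant of the images under \<open>f\<^sub>n\<^sub>-\<^sub>1\<close> and \<open>E0\<close> does not vanish.\<close>
    have "x_par * q_par powi (int b - int (m - b) + (int a - int (l - a))) \<noteq> y_par * q_par powi 0"
      by (rule x_par_y_par_generic)
    then have "y_par - x_par * (q_par powi (int b - int (m - b)) * q_par powi (int a - int (l - a))) \<noteq> 0"
      by (simp add: power_int_add)
    moreover have "qint (l - a) * (y_par * qint (m - b)) -
        q_par powi (int a - int (l - a)) * qint (m - b) * (x_par * qint (l - a) * q_par powi (int b - int (m - b))) =
      qint (l - a) * qint (m - b) *
        (y_par - x_par * (q_par powi (int b - int (m - b)) * q_par powi (int a - int (l - a))))"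
      by (simp add: algebra_simps)
    ultimately have det: "qint (l - a) * (y_par * qint (m - b)) -
        q_par powi (int a - int (l - a)) * qint (m - b) * (x_par * qint (l - a) * q_par powi (int b - int (m - b))) \<noteq> 0"
      using less by simp
    have 2: "(x_par * qint (l - a) * q_par powi (int b - int (m - b))) \<cdot>\<^sub>K row_ket (a + 1) (l - a - 1) b (m - b) +
        (y_par * qint (m - b)) \<cdot>\<^sub>K row_ket a (l - a) (b + 1) (m - b - 1) \<in> ?H"
      using 2 unfolding E0_row_ket by (subst add.commute)
    show ?thesis
      using subspace_solve2[OF H det 1[unfolded act_f_last] 2] by (intro conjI)
  qed
  show ?case
  proof (cases a)
    case 0
    then show ?thesis
      using *[of 0 N] Suc.prems by auto
  next
    case (Suc a')
    then have "a = a' + 1" "a' + b = N"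
      using Suc.prems by auto
    then show ?thesis
      using *[of a' b] unfolding diff_diff_left by blast
  qed
qed

definition eigenvalue :: "nat \<Rightarrow> nat \<Rightarrow> scal \<Rightarrow> nat \<Rightarrow> scal" where
  "eigenvalue l m z s = (\<Prod>i = 1..s. (1 - q_par powi (int l + int m - 2 * int i + 2) * z)
                     / (z - q_par powi (int l + int m - 2 * int i + 2)))"

text \<open>The image of a singular vector is a singular two-row vector, hence a multiple of \<open>xi\<close>. Applying
  \<open>F0\<close> before and after the intertwiner relates the multiples for \<open>s + 1\<close> and \<open>s\<close>: their ratio is the
  quotient of the two constants of \<open>F0_xi\<close>, for \<open>(l, m, x, y)\<close> and for \<open>(m, l, y, x)\<close>.\<close>
lemma intertwiner_xi:
  assumes T: "intertwiner l m T" and T0: "T (row_ket 0 l 0 m) = row_ket 0 m 0 l"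
    and "s \<le> l" "s \<le> m"
  shows "T (xi n l m s) = eigenvalue l m (x_par / y_par) s \<cdot>\<^sub>K xi n m l s"
  using assms(3-)
proof (induction s)
  case 0
  have "xi n l m 0 = row_ket 0 l 0 m" for l m
    by (simp add: xi_eq_level level_def xi_coeff_def qbinom_def qfact_def)
  then show ?case
    using T0 by (simp add: eigenvalue_def)
next
  case (Suc s)
  let ?W = "WW n (eps \<kappa>) l m"
  have xi_W: "xi n l m (Suc s) \<in> ?W"
    using Suc.prems by (simp add: xi_eq_level level_mem_WW)
  have T_lin: "T \<in> lin_hom ?W (WW n (eps \<kappa>) m l)"
    by (rule intertwiner_lin_hom[OF T])
  have "smul.subspace {v \<in> ?W. T v \<in> level_space m l (Suc s)}" (is "smul.subspace ?H")
    by (rule lin_hom_subspace_preimage[OF T_lin subspace_WW subspace_level_space])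
  moreover have "row_ket j (l - j) (Suc s - j) (m - (Suc s - j)) \<in> ?H" if "j \<le> Suc s" for j
    using that Suc.prems by (intro CollectI conjI row_ket_mem_WW intertwiner_level[OF T T0]) auto
  ultimately have "xi n l m (Suc s) \<in> ?H"
    unfolding xi_eq_level[OF Suc.prems(2)] level_def
    by (intro smul.subspace_sum smul.subspace_scale) (simp_all only: atMost_iff)
  then obtain c where c: "T (xi n l m (Suc s)) = level m l (Suc s) c"
    by (auto simp: level_space_def)
  have T_0: "T 0 = 0"
    using smul.subspace_0[OF lin_hom_subspace_preimage[OF T_lin subspace_WW smul.subspace_single_0]] by simp
  have n: "gen_index (Gen_e (n - 1)) < n"
    using n_ge_2 by simp
  have "act y_par x_par (Gen_e (n - 1)) (T (xi n l m (Suc s))) = T (act x_par y_par (Gen_e (n - 1)) (xi n l m (Suc s)))"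
    by (rule intertwiner_act[OF T n xi_W, symmetric])
  then have "act y_par x_par (Gen_e (n - 1)) (level m l (Suc s) c) = 0"
    unfolding e_xi[OF Suc.prems] c T_0 .
  then obtain a where a: "T (xi n l m (Suc s)) = a \<cdot>\<^sub>K xi n m l (Suc s)"
    using singular_unique[OF Suc.prems(2,1)] c by metis
  define Q where "Q = q_par powi (int l + int m - 2 * int s)"
  define u where "u = q_par powi (2 * int s)"
  have u: "u \<noteq> 0" "q_par powi (int l + int m) = Q * u" "q_par powi (int m + int l) = Q * u"
    by (simp_all add: u_def Q_def add.commute flip: power_int_add)
  have ne: "x_par - Q * y_par \<noteq> 0"
    using x_par_y_par_generic[of 0 "int l + int m - 2 * int s"] by (simp add: Q_def mult.commute)
  have xi_W': "xi n l m s \<in> ?W"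
    using Suc.prems by (simp add: xi_eq_level level_mem_WW)
  have "F0 y_par x_par (T (xi n l m (Suc s))) = T (F0 x_par y_par (xi n l m (Suc s)))"
    using intertwiner_F0[OF T xi_W] by simp
  also have "\<dots> = (qint (Suc s) * (inverse y_par * (Q * u) - inverse x_par * u)) \<cdot>\<^sub>K T (xi n l m s)"
    using T_lin xi_W' unfolding F0_xi[OF Suc.prems] u(2) u_def[symmetric] lin_hom_def by simp
  finally have "(a * (qint (Suc s) * (inverse x_par * (Q * u) - inverse y_par * u))) \<cdot>\<^sub>K xi n m l s =
    (qint (Suc s) * (inverse y_par * (Q * u) - inverse x_par * u) * eigenvalue l m (x_par / y_par) s) \<cdot>\<^sub>K xi n m l s"
    using Suc.IH Suc.prems
    unfolding a smul_pair.linear_scale[OF linear_map_F0] F0_xi[OF Suc.prems(2,1)] u(3) by (simp add: u_def)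
  then have "a * (qint (Suc s) * (inverse x_par * (Q * u) - inverse y_par * u)) =
    qint (Suc s) * (inverse y_par * (Q * u) - inverse x_par * u) * eigenvalue l m (x_par / y_par) s"
    using xi_nonzero[of s l m] Suc.prems by simp
  then have "(u * qint (Suc s)) * (a * (Q * y_par - x_par)) =
      (u * qint (Suc s)) * ((Q * x_par - y_par) * eigenvalue l m (x_par / y_par) s)"
    by (simp add: field_simps)
  moreover have "u * qint (Suc s) \<noteq> 0"
    using u(1) by simp
  ultimately have "a * (Q * y_par - x_par) = (Q * x_par - y_par) * eigenvalue l m (x_par / y_par) s"
    using mult_left_cancel by blast
  then have "a = (Q * x_par - y_par) / (Q * y_par - x_par) * eigenvalue l m (x_par / y_par) s"
    using ne by (simp add: field_simps)
  also have "(Q * x_par - y_par) / (Q * y_par - x_par) = (1 - Q * (x_par / y_par)) / (x_par / y_par - Q)"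
    using ne by (simp add: divide_simps) (simp add: algebra_simps)
  also have "\<dots> * eigenvalue l m (x_par / y_par) s = eigenvalue l m (x_par / y_par) (Suc s)"
    by (simp add: eigenvalue_def Q_def mult.commute algebra_simps)
  finally show ?case
    using a by simp
qed

end

section \<open>Generation by singular vectors\<close>

lemma weighted_sum_shift:
  assumes "finite I" "i \<in> I" "i + 1 \<in> I" "0 < r i" "i < n"
  shows "(\<Sum>j\<in>I. (n - j) * shift i (i + 1) r j) < (\<Sum>j\<in>I. (n - j) * r j)"
proof -
  have 1: "(\<Sum>j\<in>I. f j) = f i + (f (i + 1) + (\<Sum>j\<in>I - {i} - {i + 1}. f j))" for f :: "nat \<Rightarrow> nat"
    using assms by (simp add: sum.remove[of I i] sum.remove[of "I - {i}" "i + 1"])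
  obtain k where k: "r i = Suc k"
    using assms(4) gr0_conv_Suc by blast
  obtain d where d: "n - i = Suc d" "n - (i + 1) = d"
    using assms(5) by (metis Suc_diff_Suc Suc_eq_plus1)
  have "(\<Sum>j\<in>I - {i} - {i + 1}. (n - j) * shift i (i + 1) r j) = (\<Sum>j\<in>I - {i} - {i + 1}. (n - j) * r j)"
    by (rule sum.cong) (auto simp: shift_def)
  then show ?thesis
    unfolding 1 d by (simp add: shift_def k)
qed

context rows
begin

text \<open>Every multi-index is reached from one supported on the rows from \<open>t\<close> on by moves from a row to
  its left neighbour. Undoing the last move at the rightmost occupied row left of \<open>t\<close> never puts two
  particles on a \<open>V\<close> factor, because the row to the right of it is either empty or bosonic.\<close>
lemma midxs_deg_induct [consumes 3, case_names base step]:
  assumes "\<kappa> < t" "t \<le> n" "r \<in> midxs_deg n (eps \<kappa>) d"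
    and base: "\<And>r. r \<in> midxs_deg n (eps \<kappa>) d \<Longrightarrow> (\<And>i. i < t \<Longrightarrow> r i = 0) \<Longrightarrow> P r"
    and step: "\<And>i r. 0 < i \<Longrightarrow> i < t \<Longrightarrow> r \<in> midxs_deg n (eps \<kappa>) d \<Longrightarrow> 0 < r (i + 1) \<Longrightarrow>
      shift (i + 1) i r \<in> midxs_deg n (eps \<kappa>) d \<Longrightarrow> P r \<Longrightarrow> P (shift (i + 1) i r)"
  shows "P r"
  using assms(3)
proof (induction r rule: measure_induct_rule[of "\<lambda>r. \<Sum>j=1..n. (n - j) * r j"])
  case (less r)
  show ?case
  proof (cases "\<forall>i<t. r i = 0")
    case True
    then show ?thesis
      using base less.prems by blast
  next
    case False
    define i where "i = Max {i. i < t \<and> 0 < r i}"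
    have "i \<in> {i. i < t \<and> 0 < r i}"
      unfolding i_def using False by (intro Max_in) auto
    then have i: "i < t" "0 < r i"
      by auto
    have max: "j \<le> i" if "j < t" "0 < r j" for j
      unfolding i_def using that by (intro Max_ge) auto
    have r: "r \<in> midxs n (eps \<kappa>)"
      using less.prems by (simp add: midxs_deg_def)
    then have "0 < i"
      using i(2) by (cases "i = 0") (auto simp: midxs_def)
    then have I: "i \<in> {1..n}" "i + 1 \<in> {1..n}" "i \<noteq> i + 1" "i < n"
      using i assms(2) by auto
    define r' where "r' = shift i (i + 1) r"
    have "eps \<kappa> (i + 1) = 0 \<or> r (i + 1) = 0"
      using max[of "i + 1"] assms(1) i(1) by (cases "i + 1 < t") (auto simp: eps_def)
    then have "r' \<in> midxs n (eps \<kappa>)"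
      using r I unfolding r'_def midxs_def shift_def by fastforce
    then have r': "r' \<in> midxs_deg n (eps \<kappa>) d"
      unfolding r'_def by (intro shift_mem_deg less.prems I i)
    have restore: "shift (i + 1) i r' = r"
      using i(2) by (auto simp: r'_def shift_def)
    have "P r'"
      using weighted_sum_shift[of "{1..n}" i r n] I i r' unfolding r'_def[symmetric]
      by (intro less.IH) auto
    then have "P (shift (i + 1) i r')"
      using less.prems \<open>0 < i\<close> i(1) r' restore by (intro step) (auto simp: r'_def shift_def)
    then show ?thesis
      unfolding restore .
  qed
qed

lemma q_idx_nonzero: "q_idx n (eps \<kappa>) i \<noteq> 0"
  by (simp add: q_idx_def)

lemma k_eigval_nonzero: "k_eigval n (eps \<kappa>) i p \<noteq> 0"
  by (simp add: k_eigval_def q_idx_nonzero)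

text \<open>Induction on the number of particles in row \<open>n - 1\<close>. The images of \<open>f\<^sub>n\<^sub>-\<^sub>1\<close> make neighbouring basis
  vectors of the next level proportional modulo \<open>K\<close>, so one further element suffices. If \<open>N + 1 > l\<close>
  the boundary vector is itself an image of \<open>f\<^sub>n\<^sub>-\<^sub>1\<close>. Otherwise \<open>xi\<close> is used: its coefficients alternate
  in sign in the same way as the factors of proportionality, so modulo \<open>K\<close> it is a positive, hence
  nonzero, multiple of a basis vector.\<close>
lemma two_row_generated:
  assumes K: "smul.subspace K"
    and f: "\<And>v. v \<in> K \<Longrightarrow> act x y (Gen_f (n - 1)) v \<in> K"
    and xi: "\<And>s. s \<le> l \<Longrightarrow> s \<le> m \<Longrightarrow> xi n l m s \<in> K"
    and "N \<le> m" "j \<le> N" "j \<le> l"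
  shows "row_ket j (l - j) (N - j) (m - (N - j)) \<in> K"
  using assms(4-)
proof (induction N arbitrary: j)
  case 0
  have "xi_coeff m 0 0 = 1"
    by (simp add: xi_coeff_def qbinom_def qfact_def)
  then have "xi n l m 0 = row_ket 0 l 0 m"
    by (simp add: xi_eq_level level_def)
  then show ?case
    using xi[of 0] 0 by simp
next
  case (Suc N)
  define u where "u j = row_ket j (l - j) (Suc N - j) (m - (Suc N - j))" for j
  define \<beta> where "\<beta> j = q_par powi (int j - int (l - j)) * qint (m - (N - j))" for j
  have f_u: "qint (l - j) \<cdot>\<^sub>K u (Suc j) + \<beta> j \<cdot>\<^sub>K u j \<in> K" if "j \<le> N" "j \<le> l" for j
  proof -
    have "Suc N - j = N - j + 1" "m - (Suc N - j) = m - (N - j) - 1" "l - Suc j = l - j - 1" "Suc N - Suc j = N - j"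
      using that by auto
    then have "qint (l - j) \<cdot>\<^sub>K u (Suc j) + \<beta> j \<cdot>\<^sub>K u j =
        act x y (Gen_f (n - 1)) (row_ket j (l - j) (N - j) (m - (N - j)))"
      unfolding act_f_last u_def \<beta>_def by (simp only: Suc_eq_plus1)
    then show ?thesis
      using f[OF Suc.IH[of j]] that Suc.prems by simp
  qed
  have \<beta>: "\<beta> j \<in> pos_scal" if "j \<le> N" for j
    unfolding \<beta>_def using that Suc.prems by (intro pos_scal_mult pos_scal_q_powi pos_scal_qint) auto
  have "u j \<in> K" if "j \<le> Suc N" "j \<le> l" for j
  proof (cases "Suc N \<le> l")
    case False
    then have "j \<le> N"
      using that by auto
    have "l \<le> N"
      using False by auto
    show ?thesis
      using that(2)
    proof (induction j rule: inc_induct)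
      case base
      show ?case
        using f_u[OF \<open>l \<le> N\<close> order_refl] pos_scal_nonzero[OF \<beta>[OF \<open>l \<le> N\<close>]] subspace_smul_iff[OF K] by simp
    next
      case (step j)
      have j: "j \<le> N" "j \<le> l"
        using step.hyps \<open>l \<le> N\<close> by auto
      have "(qint (l - j) \<cdot>\<^sub>K u (Suc j) + \<beta> j \<cdot>\<^sub>K u j) - qint (l - j) \<cdot>\<^sub>K u (Suc j) \<in> K"
        by (intro smul.subspace_diff[OF K] smul.subspace_scale[OF K] f_u[OF j] step.IH)
      then show ?case
        using pos_scal_nonzero[OF \<beta>[OF j(1)]] subspace_smul_iff[OF K] by simp
    qed
  next
    case True
    have "\<exists>p\<in>pos_scal. u j - ((- 1) ^ j * p) \<cdot>\<^sub>K u 0 \<in> K" if "j \<le> Suc N" for j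
      using that
    proof (induction j)
      case 0
      then show ?case
        using pos_scal_1 smul.subspace_0[OF K] by (intro bexI[of _ 1]) auto
    next
      case (Suc j)
      then obtain p where p: "p \<in> pos_scal" "u j - ((- 1) ^ j * p) \<cdot>\<^sub>K u 0 \<in> K"
        by auto
      have j: "j \<le> N" "j \<le> l" "0 < l - j"
        using Suc.prems True by auto
      define A where "A = qint (l - j)"
      have A: "A \<in> pos_scal" "A \<noteq> 0"
        unfolding A_def by (rule pos_scal_qint[OF j(3)], rule pos_scal_nonzero, rule pos_scal_qint[OF j(3)])
      have "inverse A \<cdot>\<^sub>K ((A \<cdot>\<^sub>K u (Suc j) + \<beta> j \<cdot>\<^sub>K u j) - \<beta> j \<cdot>\<^sub>K (u j - ((- 1) ^ j * p) \<cdot>\<^sub>K u 0)) \<in> K"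
        unfolding A_def by (intro smul.subspace_scale[OF K] smul.subspace_diff[OF K] f_u[OF j(1,2)] p(2))
      also have "inverse A \<cdot>\<^sub>K ((A \<cdot>\<^sub>K u (Suc j) + \<beta> j \<cdot>\<^sub>K u j) - \<beta> j \<cdot>\<^sub>K (u j - ((- 1) ^ j * p) \<cdot>\<^sub>K u 0)) =
          u (Suc j) - ((- 1) ^ Suc j * (\<beta> j * p / A)) \<cdot>\<^sub>K u 0"
        using A(2) by (simp add: smul.scale_right_distrib smul.scale_right_diff_distrib field_simps)
      finally show ?case
        using p(1) A(1) \<beta>[OF j(1)] by (intro bexI[of _ "\<beta> j * p / A"] pos_scal_divide pos_scal_mult)
    qed
    then obtain p where p: "\<And>j. j \<le> Suc N \<Longrightarrow> p j \<in> pos_scal"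
        "\<And>j. j \<le> Suc N \<Longrightarrow> u j - ((- 1) ^ j * p j) \<cdot>\<^sub>K u 0 \<in> K"
      by metis
    obtain w where w: "\<And>j. w j \<in> pos_scal" "\<And>j. xi_coeff m (Suc N) j = (- 1) ^ j * w j"
      using xi_coeff_sign[of m "Suc N"] by metis
    have "xi_coeff m (Suc N) j \<cdot>\<^sub>K (u j - ((- 1) ^ j * p j) \<cdot>\<^sub>K u 0) \<in> K" if "j \<in> {..Suc N}" for j
      using that by (intro smul.subspace_scale[OF K] p(2)) simp
    then have "xi n l m (Suc N) - (\<Sum>j\<le>Suc N. xi_coeff m (Suc N) j \<cdot>\<^sub>K (u j - ((- 1) ^ j * p j) \<cdot>\<^sub>K u 0)) \<in> K"
      by (rule smul.subspace_diff[OF K xi[OF True Suc.prems(1)] smul.subspace_sum[OF K]])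
    also have "xi n l m (Suc N) = (\<Sum>j\<le>Suc N. xi_coeff m (Suc N) j \<cdot>\<^sub>K u j)"
      using Suc.prems by (simp only: xi_eq_level level_def u_def)
    also have "\<dots> - (\<Sum>j\<le>Suc N. xi_coeff m (Suc N) j \<cdot>\<^sub>K (u j - ((- 1) ^ j * p j) \<cdot>\<^sub>K u 0)) =
        (\<Sum>j\<le>Suc N. (xi_coeff m (Suc N) j * ((- 1) ^ j * p j)) \<cdot>\<^sub>K u 0)"
      by (simp only: sum_subtractf[symmetric] smul.scale_right_diff_distrib smul.scale_scale) simp
    also have "\<dots> = (\<Sum>j\<le>Suc N. w j * p j) \<cdot>\<^sub>K u 0"
    proof -
      have "xi_coeff m (Suc N) j * ((- 1) ^ j * p j) = w j * p j" for j
        using w(2)[of j] by (simp add: mult.left_commute[of _ "(- 1) ^ j"] flip: mult.assoc power_add)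
      then show ?thesis
        by (simp only: smul.scale_sum_left)
    qed
    finally have "(\<Sum>j\<le>Suc N. w j * p j) \<cdot>\<^sub>K u 0 \<in> K" .
    moreover have "(\<Sum>j\<le>Suc N. w j * p j) \<in> pos_scal"
      using p(1) w(1) by (intro pos_scal_sum pos_scal_mult) auto
    ultimately have "u 0 \<in> K"
      using subspace_smul_iff[OF K] pos_scal_nonzero by blast
    then have "(u j - ((- 1) ^ j * p j) \<cdot>\<^sub>K u 0) + ((- 1) ^ j * p j) \<cdot>\<^sub>K u 0 \<in> K"
      using that by (intro smul.subspace_add[OF K] smul.subspace_scale[OF K] p(2))
    then show ?thesis
      by simp
  qed
  then show ?case
    using Suc.prems by (simp only: u_def)
qed

text \<open>From the two-row vectors to the whole space in two steps. With the left factor in the state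
  \<open>l e\<^sub>n\<close>, the operators \<open>f\<^sub>i\<close> for \<open>i \<le> n - 2\<close> act on the right factor only, and reach everything there.
  After that, the set of left factors \<open>p\<close> such that \<open>p \<otimes> r\<close> is in \<open>K\<close> for all \<open>r\<close> is closed under all \<open>f\<^sub>i\<close>,
  since the second term of the coproduct keeps \<open>p\<close>.\<close>
lemma generated:
  assumes K: "smul.subspace K"
    and f: "\<And>i v. 0 < i \<Longrightarrow> i < n \<Longrightarrow> v \<in> K \<Longrightarrow> act x y (Gen_f i) v \<in> K"
    and xi: "\<And>s. s \<le> l \<Longrightarrow> s \<le> m \<Longrightarrow> xi n l m s \<in> K"
  shows "WW n (eps \<kappa>) l m \<subseteq> K"
proof -
  have n: "0 < n - 1" "n - 1 < n" "\<kappa> < n - 1" "\<kappa> < n"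
    using n_ge_2 kappa_le by auto
  have two_row: "\<exists>a\<le>d. r = row2 a (d - a)"
    if "r \<in> midxs_deg n (eps \<kappa>) d" "\<And>i. i < n - 1 \<Longrightarrow> r i = 0" for r d
  proof -
    have "r i = row2 (r (n - 1)) (r n) i" for i
      using that n_ge_2 by (cases "i < n - 1"; cases "i = n - 1"; cases "i = n")
        (auto simp: last_two_def midxs_deg_def midxs_def)
    then have *: "r = row2 (r (n - 1)) (r n)"
      by blast
    then have "r (n - 1) + r n = d"
      using that(1) row2_mem_deg by metis
    then have "r n = d - r (n - 1)" "r (n - 1) \<le> d"
      by auto
    then show ?thesis
      using * by metis
  qed
  have left_last: "ket (row2 0 l, r) \<in> K" if "r \<in> midxs_deg n (eps \<kappa>) m" for r
    using n(3) diff_le_self[of n 1] that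
  proof (induction rule: midxs_deg_induct)
    case (base r)
    then obtain b where b: "b \<le> m" "r = row2 b (m - b)"
      using two_row[OF base] by blast
    have "row_ket 0 (l - 0) (b - 0) (m - (b - 0)) \<in> K"
      by (rule two_row_generated[OF K f[OF n(1,2)] xi b(1)]) auto
    then show ?case
      unfolding b(2) diff_zero .
  next
    case (step i r)
    have i: "i + 1 \<le> n" "i \<le> n" "i \<noteq> 0" "0 < i + 1" "i < n"
      using step.hyps by auto
    have r: "r \<in> midxs n (eps \<kappa>)" "shift (i + 1) i r \<in> midxs n (eps \<kappa>)"
      using step.hyps by (auto simp: midxs_deg_def)
    have "row2 0 l (i + 1) = 0"
      using step.hyps by (auto simp: last_two_def)
    then have "act x y (Gen_f i) (ket (row2 0 l, r)) =
        (inverse (k_eigval n (eps \<kappa>) i (row2 0 l)) * qint (r (i + 1))) \<cdot>\<^sub>K ket (row2 0 l, shift (i + 1) i r)"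
      unfolding act_f_ket[OF row2_mem r(1)] cyc_small[OF i(4,1)] cyc_small[OF step.hyps(1) i(2)]
      using i(3) r(2) by (simp add: ket2_in_def)
    moreover have "act x y (Gen_f i) (ket (row2 0 l, r)) \<in> K"
      by (rule f[OF step.hyps(1) i(5) step.IH])
    moreover have "inverse (k_eigval n (eps \<kappa>) i (row2 0 l)) * qint (r (i + 1)) \<noteq> 0"
      using step.hyps k_eigval_nonzero by simp
    ultimately show ?case
      using subspace_smul_iff[OF K] by simp
  qed
  have all: "\<forall>r\<in>midxs_deg n (eps \<kappa>) m. ket (p, r) \<in> K" if "p \<in> midxs_deg n (eps \<kappa>) l" for p
    using n(4) order_refl[of n] that
  proof (induction rule: midxs_deg_induct)
    case (base p)
    have "p i = 0" if "i < n - 1" for i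
      using base(2)[of i] that by simp
    then obtain a where a: "p = row2 a (l - a)"
      using two_row[OF base(1)] by blast
    have "a = 0"
      using base(2)[OF n(2)] unfolding a row2_apply .
    then have "p = row2 0 l"
      using a by simp
    then show ?case
      using left_last by blast
  next
    case (step i p)
    show ?case
    proof
      fix r assume r_deg: "r \<in> midxs_deg n (eps \<kappa>) m"
      have i: "i + 1 \<le> n" "i \<le> n" "i \<noteq> 0" "0 < i + 1" "i < n" "i + 1 \<in> {1..n}" "i \<in> {1..n}" "i + 1 \<noteq> i"
        using step.hyps by auto
      have r: "r \<in> midxs n (eps \<kappa>)" and p: "p \<in> midxs n (eps \<kappa>)" "shift (i + 1) i p \<in> midxs n (eps \<kappa>)"
        using step.hyps r_deg by (auto simp: midxs_deg_def)
      let ?c = "inverse (k_eigval n (eps \<kappa>) i p)"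
      let ?w = "(?c * qint (r (i + 1))) \<cdot>\<^sub>K ket2_in p (shift (i + 1) i r)"
      have "act x y (Gen_f i) (ket (p, r)) = qint (p (i + 1)) \<cdot>\<^sub>K ket (shift (i + 1) i p, r) + ?w"
        unfolding act_f_ket[OF p(1) r] cyc_small[OF i(4,1)] cyc_small[OF step.hyps(1) i(2)]
        using i(3) p(2) r by (simp add: ket2_in_def)
      moreover have "act x y (Gen_f i) (ket (p, r)) \<in> K"
        using step.IH r_deg by (intro f[OF step.hyps(1) i(5)]) blast
      moreover have "?w \<in> K"
      proof (cases "r (i + 1) = 0 \<or> shift (i + 1) i r \<notin> midxs n (eps \<kappa>)")
        case True
        then show ?thesis
          using smul.subspace_0[OF K] by (auto simp: ket2_in_def)
      next
        case False
        then have "shift (i + 1) i r \<in> midxs_deg n (eps \<kappa>) m"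
          by (intro shift_mem_deg[OF r_deg i(6,7,8)]) auto
        then show ?thesis
          using step.IH False p by (auto simp: ket2_in_def intro: smul.subspace_scale[OF K])
      qed
      ultimately have "qint (p (i + 1)) \<cdot>\<^sub>K ket (shift (i + 1) i p, r) \<in> K"
        using smul.subspace_diff[OF K] by (metis add_diff_cancel_right')
      then show "ket (shift (i + 1) i p, r) \<in> K"
        using subspace_smul_iff[OF K] step.hyps by simp
    qed
  qed
  show ?thesis
  proof
    fix v assume v: "v \<in> WW n (eps \<kappa>) l m"
    have "id v \<in> K"
      by (rule linear_map_subspaceI[OF smul.linear_id K]) (use v all in \<open>auto simp: WW_def\<close>)
    then show "v \<in> K"
      by simp
  qed
qed

section \<open>The spectral decomposition\<close>

lemma R_matrix_intertwiner:
  assumes "is_R_matrix n (eps \<kappa>) l m R"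
  shows "intertwiner l m (\<lambda>v. tens_swap (R v))"
proof -
  have swap: "tens_swap v \<in> WW n (eps \<kappa>) m l" if "v \<in> WW n (eps \<kappa>) l m" for v
  proof (rule linear_map_subspaceI[OF linear_map_tens_swap subspace_WW])
    fix b assume "b \<in> Poly_Mapping.keys v"
    then have "b \<in> midxs_deg n (eps \<kappa>) l \<times> midxs_deg n (eps \<kappa>) m"
      using that by (auto simp: WW_def)
    then show "tens_swap (ket b) \<in> WW n (eps \<kappa>) m l"
      by (auto simp: ket_in_WW_iff)
  qed
  have "R \<in> lin_hom (WW n (eps \<kappa>) l m) (WW n (eps \<kappa>) l m)"
    using assms by (simp add: is_R_matrix_def)
  then have "(\<lambda>v. tens_swap (R v)) \<in> lin_hom (WW n (eps \<kappa>) l m) (WW n (eps \<kappa>) m l)"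
    using swap unfolding lin_hom_def
    by (simp add: smul_pair.linear_add[OF linear_map_tens_swap] smul_pair.linear_scale[OF linear_map_tens_swap])
  then show ?thesis
    unfolding intertwiner_def using R_matrix_intertwines[OF assms] by blast
qed

lemma lin_hom_sum_smul:
  assumes "\<And>s. s \<in> I \<Longrightarrow> P s \<in> lin_hom A B"
  shows "u \<in> A \<Longrightarrow> v \<in> A \<Longrightarrow> (\<Sum>s\<in>I. \<rho> s \<cdot>\<^sub>K P s (u + v)) = (\<Sum>s\<in>I. \<rho> s \<cdot>\<^sub>K P s u) + (\<Sum>s\<in>I. \<rho> s \<cdot>\<^sub>K P s v)"
    and "v \<in> A \<Longrightarrow> (\<Sum>s\<in>I. \<rho> s \<cdot>\<^sub>K P s (c \<cdot>\<^sub>K v)) = c \<cdot>\<^sub>K (\<Sum>s\<in>I. \<rho> s \<cdot>\<^sub>K P s v)"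
proof -
  assume uv: "u \<in> A" "v \<in> A"
  have "P s (u + v) = P s u + P s v" if "s \<in> I" for s
    using assms[OF that] uv unfolding lin_hom_def by blast
  then show "(\<Sum>s\<in>I. \<rho> s \<cdot>\<^sub>K P s (u + v)) = (\<Sum>s\<in>I. \<rho> s \<cdot>\<^sub>K P s u) + (\<Sum>s\<in>I. \<rho> s \<cdot>\<^sub>K P s v)"
    by (simp add: smul.scale_right_distrib sum.distrib)
next
  assume v: "v \<in> A"
  have "P s (c \<cdot>\<^sub>K v) = c \<cdot>\<^sub>K P s v" if "s \<in> I" for s
    using assms[OF that] v unfolding lin_hom_def by blast
  then show "(\<Sum>s\<in>I. \<rho> s \<cdot>\<^sub>K P s (c \<cdot>\<^sub>K v)) = c \<cdot>\<^sub>K (\<Sum>s\<in>I. \<rho> s \<cdot>\<^sub>K P s v)"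
    by (simp add: smul.scale_sum_right mult.commute)
qed

lemma lin_hom_sum_intertwiner:
  assumes "\<And>s. s \<in> I \<Longrightarrow> is_P_op n (eps \<kappa>) l m s (P s)" "gen_index g \<in> {1..<n}" "v \<in> WW n (eps \<kappa>) l m"
  shows "(\<Sum>s\<in>I. \<rho> s \<cdot>\<^sub>K P s (act x_par y_par g v)) = act y_par x_par g (\<Sum>s\<in>I. \<rho> s \<cdot>\<^sub>K P s v)"
  unfolding act_sum act_smul
  by (intro sum.cong refl arg_cong2[where f = smul] P_op_intertwines[OF assms(1) assms(2,3)])

text \<open>The operators are only assumed to be linear on \<open>A\<close>, which is why this is not an instance of the
  kernel of a linear map.\<close>
lemma lin_hom_equalizer_subspace:
  assumes A: "smul.subspace A" and S: "S \<in> lin_hom A B" and T: "T \<in> lin_hom A B"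
  shows "smul.subspace {v \<in> A. S v = T v}"
proof (rule smul.subspaceI)
  have "S (0 \<cdot>\<^sub>K 0) = 0 \<cdot>\<^sub>K S 0" "T (0 \<cdot>\<^sub>K 0) = 0 \<cdot>\<^sub>K T 0"
    using S T smul.subspace_0[OF A] unfolding lin_hom_def by blast+
  then show "0 \<in> {v \<in> A. S v = T v}"
    using smul.subspace_0[OF A] by simp
next
  fix u v assume "u \<in> {v \<in> A. S v = T v}" "v \<in> {v \<in> A. S v = T v}"
  moreover from this have "S (u + v) = S u + S v" "T (u + v) = T u + T v"
    using S T unfolding lin_hom_def by blast+
  ultimately show "u + v \<in> {v \<in> A. S v = T v}"
    using smul.subspace_add[OF A] by simp
next
  fix c v assume "v \<in> {v \<in> A. S v = T v}"
  moreover from this have "S (c \<cdot>\<^sub>K v) = c \<cdot>\<^sub>K S v" "T (c \<cdot>\<^sub>K v) = c \<cdot>\<^sub>K T v"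
    using S T unfolding lin_hom_def by blast+
  ultimately show "c \<cdot>\<^sub>K v \<in> {v \<in> A. S v = T v}"
    using smul.subspace_scale[OF A] by simp
qed

lemma spectral_decomposition:
  assumes R: "is_R_matrix n (eps \<kappa>) l m R"
    and P: "\<And>s. s \<le> min l m \<Longrightarrow> is_P_op n (eps \<kappa>) l m s (P s)"
    and v: "v \<in> WW n (eps \<kappa>) l m"
  shows "tens_swap (R v) = (\<Sum>s = 0..min l m. eigenvalue l m (x_par / y_par) s \<cdot>\<^sub>K P s v)"
proof -
  let ?W = "WW n (eps \<kappa>) l m" and ?\<rho> = "eigenvalue l m (x_par / y_par)"
  define S where "S v = (\<Sum>s = 0..min l m. ?\<rho> s \<cdot>\<^sub>K P s v)" for v
  let ?T = "\<lambda>v. tens_swap (R v)"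
  have T: "intertwiner l m ?T"
    by (rule R_matrix_intertwiner[OF R])
  have P_lin: "P s \<in> lin_hom ?W (WW n (eps \<kappa>) m l)" if "s \<in> {0..min l m}" for s
    using P[of s] that by (simp add: is_P_op_def)
  have S_W: "S v \<in> WW n (eps \<kappa>) m l" if "v \<in> ?W" for v
    unfolding S_def using P_lin that unfolding lin_hom_def
    by (intro smul.subspace_sum[OF subspace_WW] smul.subspace_scale[OF subspace_WW]) blast
  have S: "S \<in> lin_hom ?W (WW n (eps \<kappa>) m l)"
    using S_W lin_hom_sum_smul[of "{0..min l m}" P ?W, OF P_lin] unfolding lin_hom_def S_def by blast
  let ?K = "{v \<in> ?W. ?T v = S v}"
  have "?W \<subseteq> ?K"
  proof (rule generated)
    show "smul.subspace ?K"
      by (rule lin_hom_equalizer_subspace[OF subspace_WW intertwiner_lin_hom[OF T] S])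
  next
    fix i v assume i: "0 < i" "i < n" and v: "v \<in> ?K"
    have g: "gen_index (Gen_f i) < n" "gen_index (Gen_f i) \<in> {1..<n}" "\<exists>j. Gen_f i = Gen_e j \<or> Gen_f i = Gen_f j"
      using i by auto
    have W: "v \<in> ?W" and eq: "?T v = S v"
      using v by auto
    have "S (act x_par y_par (Gen_f i) v) = act y_par x_par (Gen_f i) (S v)"
      unfolding S_def by (rule lin_hom_sum_intertwiner[OF _ g(2) W]) (use P in simp)
    then have "?T (act x_par y_par (Gen_f i) v) = S (act x_par y_par (Gen_f i) v)"
      unfolding intertwiner_act[OF T g(1) W] eq by simp
    then show "act x_par y_par (Gen_f i) v \<in> ?K"
      using act_mem_WW[OF g(1) W g(3)] by blast
  next
    fix s assume s: "s \<le> l" "s \<le> m"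
    have last: "single_idx n d = row2 0 d" for d
      by (rule ext) (use n_ge_2 in \<open>auto simp: single_idx_def last_two_def\<close>)
    have "R (row_ket 0 l 0 m) = row_ket 0 l 0 m"
      using R by (simp add: is_R_matrix_def last)
    then have "?T (xi n l m s) = ?\<rho> s \<cdot>\<^sub>K xi n m l s"
      using s by (intro intertwiner_xi[OF T]) auto
    moreover have "S (xi n l m s) = (\<Sum>s' = 0..min l m. if s' = s then ?\<rho> s \<cdot>\<^sub>K xi n m l s else 0)"
      unfolding S_def
    proof (intro sum.cong refl)
      fix s' assume "s' \<in> {0..min l m}"
      then show "?\<rho> s' \<cdot>\<^sub>K P s' (xi n l m s) = (if s' = s then ?\<rho> s \<cdot>\<^sub>K xi n m l s else 0)"
        using P[of s'] s by (auto simp: is_P_op_def)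
    qed
    moreover have "xi n l m s \<in> ?W"
      using s by (simp add: xi_eq_level level_mem_WW)
    ultimately show "xi n l m s \<in> ?K"
      using s by simp
  qed
  then show ?thesis
    using v unfolding S_def by blast
qed

end

theorem mainTheorem10:
  fixes n \<kappa> l m :: nat
    and R :: "(midx \<times> midx \<Rightarrow>\<^sub>0 scal) \<Rightarrow> (midx \<times> midx \<Rightarrow>\<^sub>0 scal)"
    and PP :: "nat \<Rightarrow> (midx \<times> midx \<Rightarrow>\<^sub>0 scal) \<Rightarrow> (midx \<times> midx \<Rightarrow>\<^sub>0 scal)"
    and z :: scal
  assumes "n \<ge> 2"
    and "\<kappa> \<le> n - 2"
    and "z = x_par / y_par"
    and "is_R_matrix n (eps \<kappa>) l m R"
    and "\<And>s. s \<le> min l m \<Longrightarrow> is_P_op n (eps \<kappa>) l m s (PP s)"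
  shows "\<forall>v\<in>WW n (eps \<kappa>) l m.
    tens_swap (R v) =
      (\<Sum>s = 0..min l m.
        (\<Prod>i = 1..s. (1 - q_par powi (int l + int m - 2 * int i + 2) * z)
                     / (z - q_par powi (int l + int m - 2 * int i + 2)))
          \<cdot>\<^sub>K PP s v)"
proof -
  interpret rows n \<kappa>
    using assms(1,2) by unfold_locales
  show ?thesis
    using spectral_decomposition[OF assms(4,5)] unfolding eigenvalue_def assms(3) by blast
qed

end
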